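(* Let $a,T>0$, $0<\alpha<1$, $\Omega=(0,a)\times(0,T]$, $\overline{\Omega}=[0,a]\times[0,T]$. Let $F:\overline{\Omega}\to\mathbb{R}$, $\varphi:[0,a]\to\mathbb{R}$, $\lambda,\mu:[0,T]\to\mathbb{R}$ be continuous, with $\lambda$ and $\mu$ nondecreasing. Then the problem $$\frac{\partial u}{\partial t}(x,t)=\frac{\partial^2}{\partial x^2}D_{*t}^{1-\alpha}u(x,t)+F(x,t)\quad\text{in }\Omega,$$ $$u(x,0)=\varphi(x),\ x\in[0,a],\qquad u(0,t)=\lambda(t),\quad u(a,t)=\mu(t),\ 0\le t\le T,$$ has at most one classical solution.
   Context: The Mittag-Leffler function is $E_{\alpha,\beta}(z)=\sum_{k=0}^{\infty}\frac{z^k}{\Gamma(\alpha k+\beta)}$. For $0<\gamma<1$ and $f\in W^1_2([0,T])$ (Sobolev space), the Atangana-Baleanu fractional derivative of order $\gamma$ (with normalization function taken identically equal to $1$ and lower limit $0$) is $$D_*^{\gamma}f(t)=\frac{1}{1-\gamma}\int_0^t f'(s)\,E_{\gamma,1}\!\left[-\gamma\frac{(t-s)^{\gamma}}{1-\gamma}\right]ds .$$ $D_{*t}^{\gamma}u(x,t)$ denotes this derivative applied to $t\mapsto u(x,t)$ for fixed $x$. A (classical) solution is a function $u\in C([0,a]\times[0,T])\cap C^{2,1}((0,a)\times(0,T])$ (twice continuously differentiable in $x$, once in $t$) for which the quantities appearing in the equation exist and which satisfies the equation pointwise in $\Omega$ together with the initial and boundary conditions. *)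

theory Defs
  imports "HOL-Analysis.Analysis"
begin

definition mittag_leffler :: "real \<Rightarrow> real \<Rightarrow> real \<Rightarrow> real" where
  "mittag_leffler \<alpha> \<beta> z = (\<Sum>k. z ^ k / Gamma (\<alpha> * real k + \<beta>))"

definition square_integrable_on :: "(real \<Rightarrow> real) \<Rightarrow> real set \<Rightarrow> bool" where
  "square_integrable_on f S \<longleftrightarrow>
     f \<in> borel_measurable (lebesgue_on S) \<and> integrable (lebesgue_on S) (\<lambda>s. (f s)\<^sup>2)"

definition has_weak_L2_derivative_on :: "(real \<Rightarrow> real) \<Rightarrow> (real \<Rightarrow> real) \<Rightarrow> real set \<Rightarrow> bool" where
  \<comment> \<open>Test functions range over continuously differentiable functions with compact support in \<open>S\<close>,
      the usual choice on intervals (Brezis). Smooth test functions give the same notion.\<close>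
  "has_weak_L2_derivative_on f g S \<longleftrightarrow>
     square_integrable_on g S \<and>
     (\<forall>\<phi> \<phi>'. (\<forall>s. (\<phi> has_real_derivative \<phi>' s) (at s)) \<longrightarrow> continuous_on UNIV \<phi>' \<longrightarrow>
        compact (closure {s. \<phi> s \<noteq> 0}) \<longrightarrow> closure {s. \<phi> s \<noteq> 0} \<subseteq> S \<longrightarrow>
        (LINT s|lebesgue_on S. f s * \<phi>' s) = - (LINT s|lebesgue_on S. g s * \<phi> s))"

definition sobolev_W12 :: "real \<Rightarrow> (real \<Rightarrow> real) \<Rightarrow> bool" where
  "sobolev_W12 T f \<longleftrightarrow>
     square_integrable_on f {0<..<T} \<and> (\<exists>g. has_weak_L2_derivative_on f g {0<..<T})"

text \<open>Weak derivatives are unique up to null sets, so integrals involving \<open>weak_derivative T f\<close>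
  do not depend on the representative chosen here. If \<open>f\<close> is not in \<open>W\<^sup>1\<^sub>2\<close>, the value is
  meaningless.\<close>

definition weak_derivative :: "real \<Rightarrow> (real \<Rightarrow> real) \<Rightarrow> real \<Rightarrow> real" where
  "weak_derivative T f = (SOME g. has_weak_L2_derivative_on f g {0<..<T})"

definition AB_derivative :: "real \<Rightarrow> real \<Rightarrow> (real \<Rightarrow> real) \<Rightarrow> real \<Rightarrow> real" where
  "AB_derivative T \<gamma> f t =
     1 / (1 - \<gamma>) *
     (LINT s|lebesgue_on {0..t}.
        weak_derivative T f s * mittag_leffler \<gamma> 1 (- \<gamma> * ((t - s) powr \<gamma> / (1 - \<gamma>))))"

definition has_second_derivative_at :: "(real \<Rightarrow> real) \<Rightarrow> real \<Rightarrow> real \<Rightarrow> bool" where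
  "has_second_derivative_at f d x \<longleftrightarrow>
     (\<exists>f'. (\<forall>\<^sub>F y in nhds x. (f has_real_derivative f' y) (at y)) \<and>
           (f' has_real_derivative d) (at x))"

text \<open>Time derivatives are taken within \<open>(0, T]\<close>, hence are one-sided at \<open>t = T\<close>.\<close>

definition C21 :: "real \<Rightarrow> real \<Rightarrow> (real \<Rightarrow> real \<Rightarrow> real) \<Rightarrow> bool" where
  "C21 a T u \<longleftrightarrow>
     (\<exists>ux uxx ut.
        (\<forall>x\<in>{0<..<a}. \<forall>t\<in>{0<..T}.
           ((\<lambda>y. u y t) has_real_derivative ux x t) (at x) \<and>
           ((\<lambda>y. ux y t) has_real_derivative uxx x t) (at x) \<and>
           (u x has_real_derivative ut x t) (at t within {0<..T})) \<and>
        (\<forall>g\<in>{u, ux, uxx, ut}. continuous_on ({0<..<a} \<times> {0<..T}) (\<lambda>(x, t). g x t)))"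

text \<open>Membership \<open>u(x, \<cdot>) \<in> W\<^sup>1\<^sub>2([0, T])\<close> for interior \<open>x\<close> is what makes the fractional derivative
  in the equation defined.\<close>

definition classical_solution ::
  "real \<Rightarrow> real \<Rightarrow> real \<Rightarrow> (real \<Rightarrow> real \<Rightarrow> real) \<Rightarrow> (real \<Rightarrow> real) \<Rightarrow> (real \<Rightarrow> real) \<Rightarrow> (real \<Rightarrow> real)
    \<Rightarrow> (real \<Rightarrow> real \<Rightarrow> real) \<Rightarrow> bool" where
  "classical_solution a T \<alpha> F \<phi> lam mu u \<longleftrightarrow>
     continuous_on ({0..a} \<times> {0..T}) (\<lambda>(x, t). u x t) \<and>
     C21 a T u \<and>
     (\<forall>x\<in>{0<..<a}. sobolev_W12 T (u x)) \<and>
     (\<forall>x\<in>{0<..<a}. \<forall>t\<in>{0<..T}. \<exists>ut vxx.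
        (u x has_real_derivative ut) (at t within {0<..T}) \<and>
        has_second_derivative_at (\<lambda>y. AB_derivative T (1 - \<alpha>) (u y) t) vxx x \<and>
        ut = vxx + F x t) \<and>
     (\<forall>x\<in>{0..a}. u x 0 = \<phi> x) \<and>
     (\<forall>t\<in>{0..T}. u 0 t = lam t \<and> u a t = mu t)"

end

theory Submission
  imports Defs
begin

text \<open>
  Write \<open>\<gamma> = 1 - \<alpha>\<close>, let \<open>w\<close> be the difference of two solutions and \<open>D\<close> the difference of
  their fractional derivatives of order \<open>\<gamma>\<close>. Then \<open>w\<close> vanishes initially and on the lateral
  boundary, and \<open>w\<^sub>t = D\<^sub>x\<^sub>x\<close> inside. The proof is a maximum principle for \<open>D\<close> rather than for \<open>w\<close>.

  The Mittag-Leffler kernel satisfies a fractional relaxation equation, so the fractional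
  derivative can be inverted: with \<open>I\<^sup>\<gamma>\<close> the Riemann-Liouville integral,
  \<open>\<alpha> D + \<gamma> I\<^sup>\<gamma> D = w\<close> (\<open>AB_derivative_W12\<close>). This rests on the semigroup law of fractional
  integration applied to the Mittag-Leffler series (\<open>rl_kernel_convolution_relaxation\<close>), on Fubini's
  theorem (\<open>convolution_assoc\<close>), and on the fact that a continuous function is a primitive of its
  weak derivative (\<open>du_Bois_Reymond\<close>).

  The inverted relation is a Volterra equation of the second kind in \<open>t\<close>, with \<open>x\<close> as a parameter.
  Its solution depends continuously on the right-hand side (\<open>Volterra_stability\<close>), so \<open>D\<close> inherits
  from \<open>w\<close> the continuity on the closed rectangle and the vanishing at \<open>x = 0\<close> and \<open>x = a\<close>.

  Suppose that \<open>D\<close> has a positive maximum. It is attained at some \<open>(x0, t0)\<close> with \<open>0 < x0 < a\<close> and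
  \<open>0 < t0\<close>, and there \<open>D\<^sub>x\<^sub>x \<le> 0\<close>. On the other hand, the inverted relation forces \<open>w\<^sub>t > 0\<close> at such
  a point (\<open>derivative_pos_at_positive_maximum\<close>), which contradicts the equation. Hence \<open>D \<le> 0\<close>, by
  symmetry \<open>D = 0\<close>, and then \<open>w = \<alpha> D + \<gamma> I\<^sup>\<gamma> D = 0\<close>.
\<close>

section \<open>Riemann-Liouville kernels and integrals\<close>

text \<open>Convolution with this kernel is the Riemann-Liouville integral of order \<open>a\<close>. It vanishes at
  \<open>0\<close> and to the left of it, so that convolutions over the whole line are convolutions over
  \<open>[0, t]\<close>.\<close>

definition rl_kernel :: "real \<Rightarrow> real \<Rightarrow> real" where
  "rl_kernel a t = (if t > 0 then t powr (a - 1) / Gamma a else 0)"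

lemma rl_kernel_measurable [measurable]: "rl_kernel a \<in> borel_measurable borel"
  unfolding rl_kernel_def[abs_def] by measurable

lemma rl_kernel_nonneg: "a > 0 \<Longrightarrow> 0 \<le> rl_kernel a t"
  by (simp add: rl_kernel_def Gamma_real_pos less_imp_le)

lemma rl_kernel_eq_0: "t \<le> 0 \<Longrightarrow> rl_kernel a t = 0"
  by (simp add: rl_kernel_def)

lemma rl_kernel_1: "rl_kernel 1 t = (if t > 0 then 1 else 0)"
  by (simp add: rl_kernel_def)

text \<open>The semigroup law of fractional integration. Rescaling \<open>[0, t]\<close> to \<open>[0, 1]\<close> turns the
  convolution into the Beta integral.\<close>

lemma rl_kernel_convolution:
  assumes a: "a > 0" and b: "b > 0"
  shows "integrable lborel (\<lambda>s. rl_kernel a (t - s) * rl_kernel b s)"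
    and "(LINT s|lborel. rl_kernel a (t - s) * rl_kernel b s) = rl_kernel (a + b) t"
proof -
  let ?F = "\<lambda>s. rl_kernel a (t - s) * rl_kernel b s"
  have "integrable lborel ?F \<and> integral\<^sup>L lborel ?F = rl_kernel (a + b) t"
  proof (cases "t > 0")
    case False
    then have "?F = (\<lambda>s. 0)" by (auto simp: rl_kernel_def)
    with False show ?thesis by (simp add: rl_kernel_def)
  next
    case True
    define B where "B = (\<lambda>s. indicator {0..1} s *\<^sub>R (s powr (b - 1) * (1 - s) powr (a - 1)) :: real)"
    define C where "C = t powr (a + b - 2) / (Gamma a * Gamma b)"
    have intB: "integrable lborel B"
      using integrable_Beta[OF b a] by (simp add: set_integrable_def B_def)
    have "integral\<^sup>L lborel B = integral {0..1} (\<lambda>s. s powr (b - 1) * (1 - s) powr (a - 1))"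
      using set_borel_integral_eq_integral(2)[OF integrable_Beta[OF b a]]
      by (simp add: set_lebesgue_integral_def B_def)
    also have "\<dots> = Beta b a"
      using has_integral_Beta_real[OF b a] by (rule integral_unique)
    finally have valB: "integral\<^sup>L lborel B = Beta b a" .
    have F_eq: "?F s = C * B (0 + (1 / t) * s)" for s
    proof (cases "0 < s \<and> s < t")
      case False
      then show ?thesis using True
        by (auto simp: rl_kernel_def B_def indicator_def field_simps)
    next
      case s: True
      have "(s / t) powr (b - 1) = s powr (b - 1) / t powr (b - 1)"
        using s True by (simp add: powr_divide)
      moreover have "(1 - s / t) powr (a - 1) = (t - s) powr (a - 1) / t powr (a - 1)"
      proof -
        have "1 - s / t = (t - s) / t" using True by (simp add: field_simps)
        then show ?thesis using s True by (simp add: powr_divide)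
      qed
      moreover have "t powr (a + b - 2) = t powr (a - 1) * t powr (b - 1)"
        by (simp add: powr_add[symmetric])
      ultimately show ?thesis using s True
        by (simp add: rl_kernel_def B_def C_def)
    qed
    have "integrable lborel (\<lambda>s. B (0 + (1 / t) * s))"
      using lborel_integrable_real_affine[OF intB, of "1 / t" 0] True by simp
    then have 1: "integrable lborel ?F" unfolding F_eq by (rule integrable_mult_right)
    have "integral\<^sup>L lborel B = (1 / t) * (LINT s|lborel. B (0 + (1 / t) * s))"
      using lborel_integral_real_affine[of "1 / t" B 0] True by simp
    then have "(LINT s|lborel. B (0 + (1 / t) * s)) = t * Beta b a"
      using True valB by (simp add: field_simps)
    then have "integral\<^sup>L lborel ?F = C * (t * Beta b a)" unfolding F_eq by simp
    also have "\<dots> = rl_kernel (a + b) t"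
    proof -
      have "t powr (a + b - 2) * t = t powr (a + b - 1)"
        using True powr_add[of t "a + b - 2" 1] by simp
      moreover have "Gamma a \<noteq> 0" "Gamma b \<noteq> 0"
        using Gamma_real_pos[OF a] Gamma_real_pos[OF b] by auto
      ultimately show ?thesis using True
        by (simp add: C_def rl_kernel_def Beta_def add.commute)
    qed
    finally show ?thesis using 1 by simp
  qed
  then show "integrable lborel ?F" "integral\<^sup>L lborel ?F = rl_kernel (a + b) t" by auto
qed

text \<open>Convolving with the step function \<open>rl_kernel 1 (s - c)\<close> integrates the kernel over \<open>[c, t]\<close>.\<close>

lemma rl_kernel_integral_from:
  assumes a: "a > 0"
  shows "integrable lborel (\<lambda>s. indicator {c..} s * rl_kernel a (t - s))"
    and "(LINT s|lborel. indicator {c..} s * rl_kernel a (t - s)) = rl_kernel (a + 1) (t - c)"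
proof -
  let ?F = "\<lambda>s. rl_kernel a (t - s) * rl_kernel 1 (s - c)"
  have F: "?F (c + 1 * s) = rl_kernel a (t - c - s) * rl_kernel 1 s" for s
    by (simp add: algebra_simps)
  have "integrable lborel (\<lambda>s. ?F (c + 1 * s))"
    unfolding F using a by (intro rl_kernel_convolution) auto
  then have int: "integrable lborel ?F" using lborel_integrable_real_affine_iff[of 1 ?F c] by simp
  have val: "integral\<^sup>L lborel ?F = rl_kernel (a + 1) (t - c)"
    using lborel_integral_real_affine[of 1 ?F c] rl_kernel_convolution(2)[OF a, of 1 "t - c"]
    unfolding F by simp
  have ae: "AE s in lborel. ?F s = indicator {c..} s * rl_kernel a (t - s)"
    using AE_lborel_singleton[of c] by (auto elim!: eventually_mono simp: rl_kernel_1 indicator_def)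
  show "integrable lborel (\<lambda>s. indicator {c..} s * rl_kernel a (t - s))"
    using int ae by (subst integrable_cong_AE[where g = ?F]) (auto elim!: eventually_mono)
  show "(LINT s|lborel. indicator {c..} s * rl_kernel a (t - s)) = rl_kernel (a + 1) (t - c)"
    unfolding val[symmetric] using ae by (intro integral_cong_AE) (auto elim!: eventually_mono)
qed

definition rl_integral :: "real \<Rightarrow> (real \<Rightarrow> real) \<Rightarrow> real \<Rightarrow> real" where
  "rl_integral a V t = (LINT s|lborel. indicator {0..t} s * (rl_kernel a (t - s) * V s))"

lemma rl_integral_integrable:
  assumes a: "a > 0" and V: "continuous_on {0..t} V"
  shows "integrable lborel (\<lambda>s. indicator {0..t} s * (rl_kernel a (t - s) * V s))"
proof -
  have "bounded (V ` {0..t})" by (intro compact_imp_bounded compact_continuous_image V) auto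
  then obtain M where M: "\<And>s. s \<in> {0..t} \<Longrightarrow> \<bar>V s\<bar> \<le> M" by (force simp: bounded_iff)
  have [measurable]: "(\<lambda>s. indicator {0..t} s * V s) \<in> borel_measurable borel"
    using borel_measurable_continuous_on_indicator[OF _ V] by simp
  have "integrable lborel (\<lambda>s. rl_kernel a (t - s) * (indicator {0..t} s * V s))"
  proof (rule Bochner_Integration.integrable_bound)
    show "integrable lborel (\<lambda>s. M * (indicator {0..} s * rl_kernel a (t - s)))"
      by (intro integrable_mult_right rl_kernel_integral_from a)
    show "AE s in lborel. norm (rl_kernel a (t - s) * (indicator {0..t} s * V s))
        \<le> norm (M * (indicator {0..} s * rl_kernel a (t - s)))"
    proof (rule AE_I2)
      fix s
      show "norm (rl_kernel a (t - s) * (indicator {0..t} s * V s))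
        \<le> norm (M * (indicator {0..} s * rl_kernel a (t - s)))"
      proof (cases "s \<in> {0..t}")
        case True
        then have "\<bar>V s\<bar> * \<bar>rl_kernel a (t - s)\<bar> \<le> \<bar>M\<bar> * \<bar>rl_kernel a (t - s)\<bar>"
          using M[OF True] by (intro mult_right_mono) auto
        then show ?thesis using True by (simp add: abs_mult mult.commute)
      qed simp
    qed
  qed simp
  then show ?thesis by (simp add: mult_ac)
qed

lemma rl_integral_diff:
  assumes "a > 0" and "continuous_on {0..t} V" and "continuous_on {0..t} W"
  shows "rl_integral a (\<lambda>s. V s - W s) t = rl_integral a V t - rl_integral a W t"
proof -
  have "indicator {0..t} s * (rl_kernel a (t - s) * (V s - W s)) =
     indicator {0..t} s * (rl_kernel a (t - s) * V s) - indicator {0..t} s * (rl_kernel a (t - s) * W s)" for s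
    by (simp add: algebra_simps)
  then show ?thesis using assms
    by (simp only: rl_integral_def Bochner_Integration.integral_diff rl_integral_integrable)
qed

lemma rl_integral_const: "a > 0 \<Longrightarrow> rl_integral a (\<lambda>_. M) t = M * rl_kernel (a + 1) t"
proof -
  assume a: "a > 0"
  have "indicator {0..t} s * (rl_kernel a (t - s) * M) = M * (indicator {0..} s * rl_kernel a (t - s))" for s
    by (auto simp: indicator_def rl_kernel_def)
  then show ?thesis using rl_kernel_integral_from(2)[OF a, of 0 t]
    by (simp only: rl_integral_def integral_mult_right_zero diff_zero)
qed

section \<open>The Mittag-Leffler series and the relaxation kernel\<close>

text \<open>Keeping only the part of Euler's integral over \<open>[A, A + 1]\<close> already shows that \<open>Gamma x\<close> grows
  faster than every power \<open>A ^ x\<close>; this makes the Mittag-Leffler series entire.\<close>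

lemma Gamma_ge_powr:
  assumes "x \<ge> 1" and "A > (0::real)"
  shows "A powr (x - 1) / exp (A + 1) \<le> Gamma x"
proof -
  let ?f = "\<lambda>t. t powr (x - 1) / exp t"
  have G: "(?f has_integral Gamma x) {0..}" using assms by (intro Gamma_integral_real) auto
  have "?f integrable_on {A..A + 1}"
    using assms by (intro integrable_continuous_interval continuous_intros) auto
  moreover have "A powr (x - 1) / exp (A + 1) \<le> ?f t" if "t \<in> {A..A + 1}" for t
    using that assms by (intro frac_le powr_mono2) auto
  ultimately have "integral {A..A + 1} (\<lambda>_. A powr (x - 1) / exp (A + 1)) \<le> integral {A..A + 1} ?f"
    by (intro integral_le) auto
  also have "\<dots> \<le> integral {0..} ?f"
    using G \<open>?f integrable_on {A..A + 1}\<close> assms by (intro integral_subset_le) auto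
  also have "\<dots> = Gamma x" using G by (rule integral_unique)
  finally show ?thesis by simp
qed

lemma summable_mittag_leffler:
  assumes "\<alpha> > 0" and "\<beta> \<ge> 1"
  shows "summable (\<lambda>k. \<bar>z\<bar> ^ k / Gamma (\<alpha> * real k + \<beta>))"
proof -
  \<comment> \<open>This choice makes \<open>A powr \<alpha>\<close> at least \<open>2 * \<bar>z\<bar>\<close>, so the series is dominated by a geometric one.\<close>
  define A where "A = max 1 ((2 * \<bar>z\<bar>) powr (1 / \<alpha>))"
  have A: "A \<ge> 1" by (simp add: A_def)
  have z: "2 * \<bar>z\<bar> \<le> A powr \<alpha>"
  proof -
    have "2 * \<bar>z\<bar> = ((2 * \<bar>z\<bar>) powr (1 / \<alpha>)) powr \<alpha>"
      using assms by (simp add: powr_powr)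
    also have "\<dots> \<le> A powr \<alpha>" using assms by (intro powr_mono2) (auto simp: A_def)
    finally show ?thesis .
  qed
  have "norm (\<bar>z\<bar> ^ k / Gamma (\<alpha> * real k + \<beta>)) \<le> exp (A + 1) * (1 / 2) ^ k" for k
  proof -
    have x: "\<alpha> * real k + \<beta> \<ge> 1" using assms by (simp add: add_increasing)
    have "(2 * \<bar>z\<bar>) ^ k \<le> (A powr \<alpha>) ^ k" using z by (intro power_mono) auto
    also have "\<dots> = A powr (\<alpha> * real k)" using A by (simp add: powr_realpow[symmetric] powr_powr)
    also have "\<dots> \<le> A powr (\<alpha> * real k + \<beta> - 1)" using A assms by (intro powr_mono) auto
    also have "\<dots> \<le> Gamma (\<alpha> * real k + \<beta>) * exp (A + 1)"
      using Gamma_ge_powr[OF x, of A] A by (simp add: field_simps)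
    finally have "\<bar>z\<bar> ^ k * 2 ^ k \<le> Gamma (\<alpha> * real k + \<beta>) * exp (A + 1)"
      by (simp add: power_mult_distrib mult.commute)
    moreover have "Gamma (\<alpha> * real k + \<beta>) > 0" using x by (intro Gamma_real_pos) auto
    ultimately show ?thesis by (simp add: field_simps power_divide)
  qed
  moreover have "summable (\<lambda>k. exp (A + 1) * (1 / 2 :: real) ^ k)"
    by (intro summable_mult summable_geometric) auto
  ultimately show ?thesis by (rule summable_comparison_test'[where N = 0, rotated])
qed

lemma mittag_leffler_sums:
  assumes "\<alpha> > 0" and "\<beta> \<ge> 1"
  shows "(\<lambda>k. z ^ k / Gamma (\<alpha> * real k + \<beta>)) sums mittag_leffler \<alpha> \<beta> z"
proof -
  have "Gamma (\<alpha> * real k + \<beta>) > 0" for k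
    using assms by (intro Gamma_real_pos) (simp add: add_nonneg_pos)
  then have "\<bar>z ^ k / Gamma (\<alpha> * real k + \<beta>)\<bar> = \<bar>z\<bar> ^ k / Gamma (\<alpha> * real k + \<beta>)" for k
    by (simp add: power_abs less_imp_le)
  then have "summable (\<lambda>k. \<bar>z ^ k / Gamma (\<alpha> * real k + \<beta>)\<bar>)"
    using summable_mittag_leffler[OF assms, of z] by (simp only:)
  then have "summable (\<lambda>k. z ^ k / Gamma (\<alpha> * real k + \<beta>))"
    by (rule summable_rabs_cancel)
  then show ?thesis unfolding mittag_leffler_def by (rule summable_sums)
qed

lemma continuous_mittag_leffler:
  assumes "\<alpha> > 0" and "\<beta> \<ge> 1"
  shows "continuous_on UNIV (mittag_leffler \<alpha> \<beta>)"
proof -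
  have eq: "mittag_leffler \<alpha> \<beta> = (\<lambda>z. \<Sum>k. (1 / Gamma (\<alpha> * real k + \<beta>)) * z ^ k)"
    by (simp add: mittag_leffler_def fun_eq_iff)
  have "isCont (\<lambda>z. \<Sum>k. (1 / Gamma (\<alpha> * real k + \<beta>)) * z ^ k) z" for z
  proof (rule isCont_powser)
    show "summable (\<lambda>k. (1 / Gamma (\<alpha> * real k + \<beta>)) * (\<bar>z\<bar> + 1) ^ k)"
      using sums_summable[OF mittag_leffler_sums[OF assms, of "\<bar>z\<bar> + 1"]] by simp
  qed simp
  then show ?thesis unfolding eq by (simp add: continuous_on_eq_continuous_at)
qed

text \<open>The solution of the fractional relaxation equation with rate \<open>c\<close> and initial value \<open>1\<close>,
  extended by zero to the left. With \<open>c = \<gamma> / (1 - \<gamma>)\<close> it is the kernel of the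
  Atangana-Baleanu derivative of order \<open>\<gamma>\<close>.\<close>

definition relaxation_kernel :: "real \<Rightarrow> real \<Rightarrow> real \<Rightarrow> real" where
  "relaxation_kernel \<gamma> c t = (if t > 0 then mittag_leffler \<gamma> 1 (- c * t powr \<gamma>) else 0)"

lemma mittag_leffler_measurable [measurable]:
  "\<gamma> > 0 \<Longrightarrow> mittag_leffler \<gamma> 1 \<in> borel_measurable borel"
  by (rule borel_measurable_continuous_onI, rule continuous_mittag_leffler) auto

lemma relaxation_kernel_measurable [measurable]:
  assumes "\<gamma> > 0" shows "relaxation_kernel \<gamma> c \<in> borel_measurable borel"
proof -
  note [measurable] = mittag_leffler_measurable[OF assms]
  show ?thesis unfolding relaxation_kernel_def[abs_def] by measurable
qed

lemma relaxation_kernel_sums: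
  assumes "\<gamma> > 0"
  shows "(\<lambda>k. (- c) ^ k * rl_kernel (\<gamma> * real k + 1) t) sums relaxation_kernel \<gamma> c t"
proof (cases "t > 0")
  case True
  have "(- c) ^ k * rl_kernel (\<gamma> * real k + 1) t = (- c * t powr \<gamma>) ^ k / Gamma (\<gamma> * real k + 1)" for k
  proof -
    have "(- c * t powr \<gamma>) ^ k = (- c) ^ k * t powr (\<gamma> * real k)"
      using True by (simp only: power_mult_distrib powr_power) (simp add: mult.commute)
    then show ?thesis using True by (simp only: rl_kernel_def if_True) simp
  qed
  then show ?thesis using mittag_leffler_sums[OF assms, of 1 "- c * t powr \<gamma>"] True
    by (simp add: relaxation_kernel_def)
qed (simp add: rl_kernel_def relaxation_kernel_def)

lemma summable_abs_kernel_series: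
  assumes "\<gamma> > 0" and "\<beta> \<ge> 1"
  shows "summable (\<lambda>k. \<bar>c\<bar> ^ k * rl_kernel (\<gamma> * real k + \<beta>) t)"
proof (cases "t > 0")
  case True
  have "\<bar>c\<bar> ^ k * rl_kernel (\<gamma> * real k + \<beta>) t
      = t powr (\<beta> - 1) * (\<bar>c * t powr \<gamma>\<bar> ^ k / Gamma (\<gamma> * real k + \<beta>))" for k
  proof -
    have "t powr (\<gamma> * real k + \<beta> - 1) = t powr (\<beta> - 1) * (t powr \<gamma>) ^ k"
      using True by (simp add: powr_power powr_add[symmetric] algebra_simps)
    then show ?thesis using True
      by (simp add: rl_kernel_def power_mult_distrib abs_mult)
  qed
  then show ?thesis
    using summable_mult[OF summable_mittag_leffler[OF assms, of "c * t powr \<gamma>"], of "t powr (\<beta> - 1)"]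
    by (simp only:)
qed (simp add: rl_kernel_def)

text \<open>By the semigroup law, fractional integration of order \<open>\<gamma>\<close> shifts the series of the
  relaxation kernel by one index; multiplied by \<open>- c\<close>, the shifted series is the original one
  without its leading term. This identity is what inverts the Atangana-Baleanu derivative. Absolute convergence of the
  Mittag-Leffler series with parameters \<open>1\<close> and \<open>\<gamma> + 1\<close> justifies integrating term by term.\<close>

lemma rl_kernel_convolution_relaxation:
  assumes g: "\<gamma> > 0"
  shows "integrable lborel (\<lambda>s. rl_kernel \<gamma> (t - s) * relaxation_kernel \<gamma> c s)"
    and "c * (LINT s|lborel. rl_kernel \<gamma> (t - s) * relaxation_kernel \<gamma> c s)
           = rl_kernel 1 t - relaxation_kernel \<gamma> c t"
proof -
  define f where "f = (\<lambda>k s. (- c) ^ k * (rl_kernel \<gamma> (t - s) * rl_kernel (\<gamma> * real k + 1) s))"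
  have pos: "\<gamma> * real k + 1 > 0" for k using g by (simp add: add_nonneg_pos)
  have f_int: "integrable lborel (f k)" for k
    unfolding f_def by (intro integrable_mult_right rl_kernel_convolution g pos)
  have norm_f: "norm (f k s) = \<bar>c\<bar> ^ k * (rl_kernel \<gamma> (t - s) * rl_kernel (\<gamma> * real k + 1) s)" for k s
    using rl_kernel_nonneg[OF g] rl_kernel_nonneg[OF pos] by (simp add: f_def abs_mult power_abs)
  have exps: "\<gamma> + (\<gamma> * real k + 1) = \<gamma> * real (Suc k) + 1" "\<gamma> + (\<gamma> * real k + 1) = \<gamma> * real k + (\<gamma> + 1)" for k
    by (simp_all add: algebra_simps)
  have val: "integral\<^sup>L lborel (f k) = (- c) ^ k * rl_kernel (\<gamma> * real (Suc k) + 1) t" for k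
    unfolding f_def using rl_kernel_convolution(2)[OF g pos, of t k] by (simp add: exps(1) del: of_nat_Suc)
  have s1: "AE s in lborel. summable (\<lambda>k. norm (f k s))"
  proof (rule AE_I2)
    fix s
    have "summable (\<lambda>k. rl_kernel \<gamma> (t - s) * (\<bar>c\<bar> ^ k * rl_kernel (\<gamma> * real k + 1) s))"
      using summable_abs_kernel_series[OF g, of 1 c s] by (intro summable_mult) auto
    then show "summable (\<lambda>k. norm (f k s))" unfolding norm_f by (simp only: mult.left_commute)
  qed
  have s2: "summable (\<lambda>k. LINT s|lborel. norm (f k s))"
  proof -
    have "(LINT s|lborel. norm (f k s)) = \<bar>c\<bar> ^ k * rl_kernel (\<gamma> * real k + (\<gamma> + 1)) t" for k
      unfolding norm_f using rl_kernel_convolution(2)[OF g pos, of t k] by (simp add: exps(2))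
    then show ?thesis using summable_abs_kernel_series[OF g, of "\<gamma> + 1" c t] g by simp
  qed
  have lim: "(\<Sum>k. f k s) = rl_kernel \<gamma> (t - s) * relaxation_kernel \<gamma> c s" for s
    using sums_mult[OF relaxation_kernel_sums[OF g, of c s], of "rl_kernel \<gamma> (t - s)"]
    by (simp add: f_def mult_ac sums_iff)
  show "integrable lborel (\<lambda>s. rl_kernel \<gamma> (t - s) * relaxation_kernel \<gamma> c s)"
    using integrable_suminf[OF f_int s1 s2] by (simp add: lim)
  let ?I = "LINT s|lborel. rl_kernel \<gamma> (t - s) * relaxation_kernel \<gamma> c s"
  have "(\<lambda>k. integral\<^sup>L lborel (f k)) sums ?I"
    using sums_integral[OF f_int s1 s2] by (simp add: lim)
  then have "(\<lambda>k. (- c) * ((- c) ^ k * rl_kernel (\<gamma> * real (Suc k) + 1) t)) sums (- c * ?I)"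
    unfolding val by (rule sums_mult)
  then have 1: "(\<lambda>k. (- c) ^ Suc k * rl_kernel (\<gamma> * real (Suc k) + 1) t) sums (- c * ?I)"
    by (simp add: mult.assoc)
  have "(\<lambda>k. (- c) ^ Suc k * rl_kernel (\<gamma> * real (Suc k) + 1) t) sums
      (relaxation_kernel \<gamma> c t - rl_kernel 1 t)"
    using relaxation_kernel_sums[OF g, of c t] by (subst sums_Suc_iff) simp
  from sums_unique2[OF 1 this] show "c * ?I = rl_kernel 1 t - relaxation_kernel \<gamma> c t" by simp
qed

lemma isCont_relaxation_kernel:
  assumes "\<gamma> > 0" and "t \<noteq> 0"
  shows "isCont (relaxation_kernel \<gamma> c) t"
proof (cases "t > 0")
  case True
  have "isCont (mittag_leffler \<gamma> 1) y" for y
    using continuous_mittag_leffler[OF assms(1), of 1] by (simp add: continuous_on_eq_continuous_at)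
  moreover have "isCont (\<lambda>t. - c * t powr \<gamma>) t"
    using True by (intro continuous_intros) auto
  ultimately have "isCont (\<lambda>t. mittag_leffler \<gamma> 1 (- c * t powr \<gamma>)) t"
    by (rule isCont_o2[rotated])
  moreover have "\<forall>\<^sub>F t in nhds t. relaxation_kernel \<gamma> c t = mittag_leffler \<gamma> 1 (- c * t powr \<gamma>)"
    using True eventually_nhds_in_open[of "{0<..}" t]
    by (auto simp: relaxation_kernel_def elim!: eventually_mono)
  ultimately show ?thesis by (simp add: isCont_cong)
next
  case False
  have "\<forall>\<^sub>F t in nhds t. relaxation_kernel \<gamma> c t = 0"
    using False assms eventually_nhds_in_open[of "{..<0}" t]
    by (auto simp: relaxation_kernel_def elim!: eventually_mono)
  then show ?thesis by (simp add: isCont_cong[where g = "\<lambda>_. 0"])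
qed

lemma relaxation_kernel_bounded:
  assumes "\<gamma> > 0"
  obtains M where "M > 0" "\<And>t. t \<le> T \<Longrightarrow> \<bar>relaxation_kernel \<gamma> c t\<bar> \<le> M"
proof -
  have "continuous_on {0..T} (\<lambda>t. mittag_leffler \<gamma> 1 (- c * t powr \<gamma>))"
    using assms
    by (intro continuous_on_compose2[OF continuous_mittag_leffler, of \<gamma> 1] continuous_intros
          continuous_on_powr') auto
  then have "bounded ((\<lambda>t. mittag_leffler \<gamma> 1 (- c * t powr \<gamma>)) ` {0..T})"
    by (intro compact_imp_bounded compact_continuous_image) auto
  then obtain M where M: "M > 0" "\<And>t. t \<in> {0..T} \<Longrightarrow> \<bar>mittag_leffler \<gamma> 1 (- c * t powr \<gamma>)\<bar> \<le> M"
    by (force simp: bounded_pos)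
  show thesis by (rule that[OF M(1)]) (use M in \<open>auto simp: relaxation_kernel_def\<close>)
qed

section \<open>Continuous functions with a weak derivative\<close>

text \<open>Truncated squares are the building blocks of piecewise quadratic splines, which give explicit
  test functions with continuous derivative.\<close>

lemma has_real_derivative_truncated_square:
  "((\<lambda>r::real. (max 0 r)\<^sup>2 / 2) has_real_derivative max 0 x) (at x)"
proof (cases x "0 :: real" rule: linorder_cases)
  case less
  have "((\<lambda>r::real. 0) has_real_derivative 0) (at x)" by simp
  then have "((\<lambda>r::real. (max 0 r)\<^sup>2 / 2) has_real_derivative 0) (at x)"
    by (rule has_field_derivative_transform_within_open[where S = "{..<0}"]) (use less in auto)
  then show ?thesis using less by simp
next
  case greater
  have "((\<lambda>r::real. r\<^sup>2 / 2) has_real_derivative x) (at x)" by (auto intro!: derivative_eq_intros)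
  then have "((\<lambda>r::real. (max 0 r)\<^sup>2 / 2) has_real_derivative x) (at x)"
    by (rule has_field_derivative_transform_within_open[where S = "{0<..}"]) (use greater in auto)
  then show ?thesis using greater by simp
next
  case equal
  have "((\<lambda>h::real. (max 0 h)\<^sup>2 / 2 / h) \<longlongrightarrow> 0) (at 0)"
  proof (rule Lim_null_comparison)
    show "\<forall>\<^sub>F h in at (0::real). norm ((max 0 h)\<^sup>2 / 2 / h) \<le> \<bar>h\<bar>"
      by (rule always_eventually) (auto simp: max_def power2_eq_square abs_mult)
    show "((\<lambda>h::real. \<bar>h\<bar>) \<longlongrightarrow> 0) (at 0)" by (intro tendsto_rabs_zero tendsto_ident_at)
  qed
  then show ?thesis using equal by (simp add: DERIV_def)
qed

text \<open>The linear B-spline with knots \<open>0, 1, 2\<close>; \<open>smooth_step\<close> is its primitive, which climbs from \<open>0\<close>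
  to \<open>1\<close> between the outer knots.\<close>

definition tent :: "real \<Rightarrow> real" where
  "tent r = max 0 r - 2 * max 0 (r - 1) + max 0 (r - 2)"

definition smooth_step :: "real \<Rightarrow> real" where
  "smooth_step r = (max 0 r)\<^sup>2 / 2 - 2 * ((max 0 (r - 1))\<^sup>2 / 2) + (max 0 (r - 2))\<^sup>2 / 2"

lemma smooth_step_deriv: "(smooth_step has_real_derivative tent x) (at x)"
  unfolding smooth_step_def[abs_def] tent_def
  by (intro derivative_intros DERIV_cmult
      has_real_derivative_truncated_square
      DERIV_chain'[OF _ has_real_derivative_truncated_square, THEN DERIV_cong])
     (auto intro!: derivative_eq_intros)

lemma tent_nonneg: "0 \<le> tent r" and tent_eq_0: "r \<le> 0 \<or> 2 \<le> r \<Longrightarrow> tent r = 0"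
  by (auto simp: tent_def max_def)

lemma continuous_on_tent [continuous_intros]:
  "continuous_on A f \<Longrightarrow> continuous_on A (\<lambda>x. tent (f x))"
  unfolding tent_def by (intro continuous_intros)

lemma smooth_step_eq: "r \<le> 0 \<Longrightarrow> smooth_step r = 0" "2 \<le> r \<Longrightarrow> smooth_step r = 1"
  by (auto simp: smooth_step_def max_def power2_eq_square field_simps)

lemma smooth_step_mono: "x \<le> y \<Longrightarrow> smooth_step x \<le> smooth_step y"
  using smooth_step_deriv tent_nonneg by (intro DERIV_nonneg_imp_nondecreasing[of x y smooth_step]) blast+

lemma smooth_step_range: "0 \<le> smooth_step r" "smooth_step r \<le> 1"
  using smooth_step_mono[of "min 0 r" r] smooth_step_mono[of r "max 2 r"]
    smooth_step_eq(1)[of "min 0 r"] smooth_step_eq(2)[of "max 2 r"] by auto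

lemma smooth_step_affine_deriv:
  "((\<lambda>s. smooth_step ((s - c) / \<delta>)) has_real_derivative tent ((x - c) / \<delta>) / \<delta>) (at x)"
  by (rule DERIV_chain'[OF _ smooth_step_deriv, THEN DERIV_cong])
     (auto intro!: derivative_eq_intros simp: divide_inverse)

text \<open>The rescaled tents have mass one, so they average \<open>f\<close> over an interval of length \<open>2 * \<delta>\<close>.\<close>

lemma tent_average:
  assumes "continuous_on {0..T} f" and "0 < \<delta>" and "0 \<le> c" and "c + 2 * \<delta> \<le> T"
    and close: "\<And>s. c \<le> s \<Longrightarrow> s \<le> c + 2 * \<delta> \<Longrightarrow> \<bar>f s - L\<bar> \<le> \<epsilon>"
  shows "\<bar>integral {0..T} (\<lambda>s. f s * (tent ((s - c) / \<delta>) / \<delta>)) - L\<bar> \<le> \<epsilon>"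
proof -
  let ?b = "\<lambda>s. tent ((s - c) / \<delta>) / \<delta>"
  have b_nonneg: "0 \<le> ?b s" for s using assms tent_nonneg by simp
  have b_cont: "continuous_on {0..T} ?b" by (intro continuous_intros) (use assms in auto)
  have "(?b has_integral smooth_step ((T - c) / \<delta>) - smooth_step ((0 - c) / \<delta>)) {0..T}"
    using assms smooth_step_affine_deriv
    by (intro fundamental_theorem_of_calculus)
       (auto simp: has_real_derivative_iff_has_vector_derivative[symmetric]
         intro: has_field_derivative_at_within)
  moreover have "2 \<le> (T - c) / \<delta>" "(0 - c) / \<delta> \<le> 0"
    using assms by (auto simp: field_simps)
  ultimately have b1: "(?b has_integral 1) {0..T}" by (simp add: smooth_step_eq)
  have int_fb: "(\<lambda>s. f s * ?b s) integrable_on {0..T}"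
    by (intro integrable_continuous_interval continuous_on_mult assms b_cont)
  have "((\<lambda>s. f s * ?b s - L * ?b s) has_integral (integral {0..T} (\<lambda>s. f s * ?b s) - L * 1)) {0..T}"
    by (intro has_integral_diff has_integral_mult_right b1 integrable_integral int_fb)
  then have d: "((\<lambda>s. (f s - L) * ?b s) has_integral (integral {0..T} (\<lambda>s. f s * ?b s) - L)) {0..T}"
    by (simp add: left_diff_distrib diff_divide_distrib)
  have "norm (integral {0..T} (\<lambda>s. (f s - L) * ?b s)) \<le> integral {0..T} (\<lambda>s. \<epsilon> * ?b s)"
  proof (rule integral_norm_bound_integral)
    show "(\<lambda>s. (f s - L) * ?b s) integrable_on {0..T}" using d by blast
    show "(\<lambda>s. \<epsilon> * ?b s) integrable_on {0..T}" using has_integral_mult_right[OF b1] by blast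
    fix s assume "s \<in> {0..T}"
    show "norm ((f s - L) * ?b s) \<le> \<epsilon> * ?b s"
    proof (cases "c \<le> s \<and> s \<le> c + 2 * \<delta>")
      case True
      then have "\<bar>f s - L\<bar> * ?b s \<le> \<epsilon> * ?b s" using close[of s] b_nonneg[of s] by (intro mult_right_mono) auto
      then show ?thesis using b_nonneg[of s] by (simp only: real_norm_def abs_mult abs_of_nonneg)
    next
      case False
      then have "(s - c) / \<delta> \<le> 0 \<or> 2 \<le> (s - c) / \<delta>" using assms by (auto simp: field_simps)
      then show ?thesis by (simp add: tent_eq_0)
    qed
  qed
  also have "\<dots> = \<epsilon>" using integral_unique[OF has_integral_mult_right[OF b1, of \<epsilon>]] by (simp only: mult_1_right)
  finally show ?thesis by (simp only: integral_unique[OF d] real_norm_def)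
qed

text \<open>The weak derivative is only Lebesgue measurable, and arbitrary outside the interval. Both the
  integrals over \<open>[0, t]\<close> and the defining identity depend only on its class modulo null sets, so a
  Borel function can take its place and all further integrals refer to \<open>lborel\<close>. Square
  integrability gives integrability because \<open>2 * \<bar>g\<bar> \<le> 1 + g\<^sup>2\<close> and the interval has finite
  measure.\<close>

lemma W12_weak_derivative_representative:
  assumes "sobolev_W12 T f"
  obtains h where "integrable lborel h" and "\<And>s. s \<notin> {0<..<T} \<Longrightarrow> h s = 0"
    and "\<And>k t. k \<in> borel_measurable borel \<Longrightarrow> t \<le> T \<Longrightarrow>
      (LINT s|lebesgue_on {0..t}. weak_derivative T f s * k s)
        = (LINT s|lborel. indicator {..t} s * (h s * k s))"
    and "\<forall>\<phi> \<phi>'. (\<forall>s. (\<phi> has_real_derivative \<phi>' s) (at s)) \<longrightarrow> continuous_on UNIV \<phi>' \<longrightarrow>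
      compact (closure {s. \<phi> s \<noteq> 0}) \<longrightarrow> closure {s. \<phi> s \<noteq> 0} \<subseteq> {0<..<T} \<longrightarrow>
      (LINT s|lebesgue_on {0<..<T}. f s * \<phi>' s) = - (LINT s|lborel. h s * \<phi> s)"
proof -
  define S where "S = {0<..<T}"
  define g where "g = weak_derivative T f"
  have "\<exists>g. has_weak_L2_derivative_on f g S" using assms by (simp add: sobolev_W12_def S_def)
  then have weak: "has_weak_L2_derivative_on f g S"
    unfolding g_def weak_derivative_def S_def by (rule someI_ex)
  then have g_meas: "g \<in> borel_measurable (lebesgue_on S)"
    and g_sq: "integrable (lebesgue_on S) (\<lambda>s. (g s)\<^sup>2)"
    by (auto simp: has_weak_L2_derivative_on_def square_integrable_on_def)
  have fin: "finite_measure (lebesgue_on S)"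
    using emeasure_bounded_finite[of "{0<..<T}"]
    by (intro finite_measureI) (simp add: S_def emeasure_restrict_space space_restrict_space)
  have g_int: "integrable (lebesgue_on S) g"
  proof (rule Bochner_Integration.integrable_bound[OF _ g_meas])
    show "integrable (lebesgue_on S) (\<lambda>s. 1 + (g s)\<^sup>2)"
      by (intro Bochner_Integration.integrable_add g_sq finite_measure.integrable_const fin)
    show "AE s in lebesgue_on S. norm (g s) \<le> norm (1 + (g s)\<^sup>2)"
    proof (rule AE_I2)
      fix s
      have "0 \<le> (\<bar>g s\<bar> - 1)\<^sup>2" by simp
      then have "2 * \<bar>g s\<bar> \<le> 1 + (g s)\<^sup>2" by (simp add: power2_diff)
      then show "norm (g s) \<le> norm (1 + (g s)\<^sup>2)" by simp
    qed
  qed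
  define g0 where "g0 = (\<lambda>s. indicator S s *\<^sub>R g s)"
  have g0_int: "integrable lebesgue g0"
    using g_int by (subst (asm) integrable_restrict_space) (auto simp: g0_def S_def)
  obtain h0 where h0: "h0 \<in> borel_measurable lborel" "AE s in lborel. g0 s = h0 s"
    using completion_ex_borel_measurable_real[OF borel_measurable_integrable[OF g0_int]] by auto
  define h where "h = (\<lambda>s. indicator S s * h0 s)"
  have h_meas [measurable]: "h \<in> borel_measurable borel"
    using h0(1) by (simp add: h_def S_def)
  have ae: "AE s in lebesgue. g0 s = h s"
    using h0(2) by (intro AE_completion) (auto simp: h_def g0_def indicator_def elim!: eventually_mono)
  have g0_meas [measurable]: "g0 \<in> borel_measurable lebesgue"
    using g0_int by (rule borel_measurable_integrable)
  have leb: "k \<in> borel_measurable lebesgue" if "k \<in> borel_measurable borel" for k :: "real \<Rightarrow> real"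
    using that by (simp add: measurable_completion)
  have swap: "(LINT s|lebesgue. g0 s * k s) = (LINT s|lborel. h s * k s)"
    if k [measurable]: "k \<in> borel_measurable borel" for k
  proof -
    note [measurable] = leb[OF k] leb[OF h_meas]
    have "(LINT s|lebesgue. g0 s * k s) = (LINT s|lebesgue. h s * k s)"
      using ae by (intro integral_cong_AE) (auto elim!: eventually_mono)
    also have "\<dots> = (LINT s|lborel. h s * k s)" by (rule integral_completion) simp
    finally show ?thesis .
  qed
  show thesis
  proof (rule that)
    show "integrable lborel h"
    proof -
      have "integrable lebesgue h"
        using g0_int ae leb[OF h_meas] by (subst integrable_cong_AE[where g = g0]) (auto elim!: eventually_mono)
      then show ?thesis by (subst (asm) integrable_completion) auto
    qed
    show "h s = 0" if "s \<notin> {0<..<T}" for s using that by (simp add: h_def S_def)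
    show "(LINT s|lebesgue_on {0..t}. weak_derivative T f s * k s)
        = (LINT s|lborel. indicator {..t} s * (h s * k s))"
      if k [measurable]: "k \<in> borel_measurable borel" and t: "t \<le> T" for k t
    proof -
      note [measurable] = leb[OF k]
      have "(LINT s|lebesgue_on {0..t}. weak_derivative T f s * k s)
          = (LINT s|lebesgue. indicator {0..t} s *\<^sub>R (g s * k s))"
        by (subst integral_restrict_space) (auto simp: g_def)
      also have "\<dots> = (LINT s|lebesgue. g0 s * (indicator {..t} s * k s))"
      proof (rule integral_cong_AE)
        \<comment> \<open>The integration domain \<open>[0, t]\<close> may contain the endpoints \<open>0\<close> and \<open>T\<close>, where the
          weak derivative is arbitrary; correcting two points keeps measurability visible.\<close>
        have eq: "indicator {0..t} s *\<^sub>R (g s * k s) = indicator {0..t} s * k s *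
            (g0 s + indicator {0} s * g 0 + indicator {T} s * g T * indicator {0<..} s)" for s
          using t by (auto simp: indicator_def g0_def S_def)
        have ind: "(\<lambda>s. indicator A s :: real) \<in> borel_measurable lebesgue" if "A \<in> sets borel" for A :: "real set"
          using that by (intro leb) simp
        note [measurable] = ind[of "{0..t}"] ind[of "{0}"] ind[of "{T}"] ind[of "{0<..}"] ind[of "{..t}"]
        show "(\<lambda>s. indicator {0..t} s *\<^sub>R (g s * k s)) \<in> borel_measurable lebesgue"
          unfolding eq by measurable
        show "(\<lambda>s. g0 s * (indicator {..t} s * k s)) \<in> borel_measurable lebesgue" by measurable
        have "AE s in lebesgue. s \<noteq> 0 \<and> s \<noteq> T"
          by (intro AE_completion AE_conjI AE_lborel_singleton)
        then show "AE s in lebesgue. indicator {0..t} s *\<^sub>R (g s * k s) = g0 s * (indicator {..t} s * k s)"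
          by (rule eventually_mono) (use t in \<open>auto simp: indicator_def g0_def S_def\<close>)
      qed
      also have "\<dots> = (LINT s|lborel. indicator {..t} s * (h s * k s))"
        by (subst swap) (auto simp: mult_ac)
      finally show ?thesis .
    qed
    show "\<forall>\<phi> \<phi>'. (\<forall>s. (\<phi> has_real_derivative \<phi>' s) (at s)) \<longrightarrow> continuous_on UNIV \<phi>' \<longrightarrow>
      compact (closure {s. \<phi> s \<noteq> 0}) \<longrightarrow> closure {s. \<phi> s \<noteq> 0} \<subseteq> {0<..<T} \<longrightarrow>
      (LINT s|lebesgue_on {0<..<T}. f s * \<phi>' s) = - (LINT s|lborel. h s * \<phi> s)"
    proof (intro allI impI)
      fix \<phi> \<phi>' :: "real \<Rightarrow> real"
      assume d: "\<forall>s. (\<phi> has_real_derivative \<phi>' s) (at s)" and test: "continuous_on UNIV \<phi>'"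
        "compact (closure {s. \<phi> s \<noteq> 0})" "closure {s. \<phi> s \<noteq> 0} \<subseteq> {0<..<T}"
      have "\<phi> \<in> borel_measurable borel"
        using d by (intro borel_measurable_continuous_onI continuous_at_imp_continuous_on ballI DERIV_isCont) auto
      have "(LINT s|lebesgue_on S. f s * \<phi>' s) = - (LINT s|lebesgue_on S. g s * \<phi> s)"
        using weak d test by (simp add: has_weak_L2_derivative_on_def S_def)
      also have "(LINT s|lebesgue_on S. g s * \<phi> s) = (LINT s|lebesgue. g0 s * \<phi> s)"
        by (subst integral_restrict_space) (auto simp: g0_def S_def mult.assoc)
      also have "\<dots> = (LINT s|lborel. h s * \<phi> s)" by (rule swap) fact
      finally show "(LINT s|lebesgue_on {0<..<T}. f s * \<phi>' s) = - (LINT s|lborel. h s * \<phi> s)"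
        by (simp add: S_def)
    qed
  qed
qed

text \<open>A continuous function is a primitive of its weak derivative. The test functions rise from
  \<open>0\<close> to \<open>1\<close> just right of \<open>0\<close> and fall back to \<open>0\<close> just left of \<open>t\<close>. Their derivatives are a
  positive tent near \<open>0\<close> and a negative one near \<open>t\<close>, so the left side of the weak identity tends
  to \<open>f 0 - f t\<close>, while by dominated convergence the right side tends to minus the integral of
  \<open>h\<close> over \<open>[0, t]\<close>.\<close>

lemma du_Bois_Reymond:
  fixes f h :: "real \<Rightarrow> real"
  assumes f: "continuous_on {0..T} f" and h: "integrable lborel h" and h0: "\<And>s. s \<notin> {0<..<T} \<Longrightarrow> h s = 0"
    and weak: "\<forall>\<phi> \<phi>'. (\<forall>s. (\<phi> has_real_derivative \<phi>' s) (at s)) \<longrightarrow> continuous_on UNIV \<phi>' \<longrightarrow>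
      compact (closure {s. \<phi> s \<noteq> 0}) \<longrightarrow> closure {s. \<phi> s \<noteq> 0} \<subseteq> {0<..<T} \<longrightarrow>
      (LINT s|lebesgue_on {0<..<T}. f s * \<phi>' s) = - (LINT s|lborel. h s * \<phi> s)"
    and t: "0 < t" "t \<le> T"
  shows "(LINT s|lborel. indicator {..t} s * h s) = f t - f 0"
proof -
  have hm [measurable]: "h \<in> borel_measurable borel" using borel_measurable_integrable[OF h] by simp
  \<comment> \<open>Starting at \<open>t / 4\<close> makes the supports \<open>[\<delta>, 3 \<delta>]\<close> and \<open>[t - 3 \<delta>, t - \<delta>]\<close> of the two
    tents lie inside the open interval.\<close>
  define \<delta> where "\<delta> = (\<lambda>n. t / real (n + 4))"
  have \<delta>: "0 < \<delta> n" "4 * \<delta> n \<le> t" for n using t by (auto simp: \<delta>_def field_simps)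
  have \<delta>_lim: "\<delta> \<longlonglongrightarrow> 0"
    unfolding \<delta>_def by (rule LIMSEQ_ignore_initial_segment, rule lim_const_over_n)
  have \<delta>_small: "\<forall>\<^sub>F n in sequentially. \<delta> n < e" if "e > 0" for e
    using \<delta>_lim that by (rule order_tendstoD(2))
  define up where "up = (\<lambda>n s. tent ((s - \<delta> n) / \<delta> n) / \<delta> n)"
  define down where "down = (\<lambda>n s. tent ((s - (t - 3 * \<delta> n)) / \<delta> n) / \<delta> n)"
  define \<phi> where "\<phi> = (\<lambda>n s. smooth_step ((s - \<delta> n) / \<delta> n) - smooth_step ((s - (t - 3 * \<delta> n)) / \<delta> n))"
  have \<phi>_zero: "\<phi> n s = 0" if "s < \<delta> n \<or> t - \<delta> n < s" for n s
  proof (cases "s < \<delta> n")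
    case True
    then have "(s - \<delta> n) / \<delta> n \<le> 0" "(s - (t - 3 * \<delta> n)) / \<delta> n \<le> 0"
      using \<delta>[of n] by (auto simp: divide_le_0_iff)
    then show ?thesis by (simp add: \<phi>_def smooth_step_eq)
  next
    case False
    then have "2 \<le> (s - \<delta> n) / \<delta> n" "2 \<le> (s - (t - 3 * \<delta> n)) / \<delta> n"
      using \<delta>[of n] that by (auto simp: pos_le_divide_eq)
    then show ?thesis by (simp add: \<phi>_def smooth_step_eq)
  qed
  have up_cont: "continuous_on A (up n)" and down_cont: "continuous_on A (down n)" for A n
    using \<delta>(1)[of n] unfolding up_def down_def by (auto intro!: continuous_intros)
  have parts: "integral {0..T} (\<lambda>s. f s * up n s) - integral {0..T} (\<lambda>s. f s * down n s)
      = - (LINT s|lborel. h s * \<phi> n s)" for n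
  proof -
    have c: "continuous_on {0..T} (\<lambda>s. f s * (up n s - down n s))"
      by (intro continuous_intros f up_cont down_cont)
    have "closure {s. \<phi> n s \<noteq> 0} \<subseteq> {\<delta> n..t - \<delta> n}"
      using \<phi>_zero by (intro closure_minimal) (auto simp: not_less[symmetric])
    moreover from this have "compact (closure {s. \<phi> n s \<noteq> 0})"
      by (meson bounded_closed_interval bounded_subset closed_closure compact_eq_bounded_closed)
    moreover have "{\<delta> n..t - \<delta> n} \<subseteq> {0<..<T}" using \<delta>[of n] t by auto
    moreover have "(\<phi> n has_real_derivative up n s - down n s) (at s)" for s
      unfolding \<phi>_def up_def down_def by (intro DERIV_diff smooth_step_affine_deriv)
    ultimately have "(LINT s|lebesgue_on {0<..<T}. f s * (up n s - down n s)) = - (LINT s|lborel. h s * \<phi> n s)"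
      by (intro weak[rule_format] continuous_intros up_cont down_cont) auto
    moreover have "(LINT s|lebesgue_on {0<..<T}. f s * (up n s - down n s))
        = integral {0<..<T} (\<lambda>s. f s * (up n s - down n s))"
    proof (rule lebesgue_integral_eq_integral)
      have "(\<lambda>s. f s * (up n s - down n s)) absolutely_integrable_on {0<..<T}"
        by (rule set_integrable_subset[OF absolutely_integrable_continuous_real[OF c]]) auto
      then show "integrable (lebesgue_on {0<..<T}) (\<lambda>s. f s * (up n s - down n s))"
        by (simp add: integrable_restrict_space set_integrable_def)
    qed simp
    moreover have "\<dots> = integral {0..T} (\<lambda>s. f s * up n s - f s * down n s)"
      by (simp add: integral_open_interval_real right_diff_distrib)
    moreover have "\<dots> = integral {0..T} (\<lambda>s. f s * up n s) - integral {0..T} (\<lambda>s. f s * down n s)"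
      by (intro Henstock_Kurzweil_Integration.integral_diff integrable_continuous_interval continuous_intros f up_cont down_cont)
    ultimately show ?thesis by simp
  qed
  have average: "(\<lambda>n. integral {0..T} (\<lambda>s. f s * (tent ((s - c n) / \<delta> n) / \<delta> n))) \<longlonglongrightarrow> f p"
    if p: "p \<in> {0..T}" and c: "\<And>n. 0 \<le> c n" "\<And>n. c n + 2 * \<delta> n \<le> T"
      "\<And>n s. c n \<le> s \<Longrightarrow> s \<le> c n + 2 * \<delta> n \<Longrightarrow> \<bar>s - p\<bar> \<le> 3 * \<delta> n" for p c
  proof (rule LIMSEQ_I)
    fix e :: real assume e: "0 < e"
    obtain d where d: "d > 0" "\<And>s. s \<in> {0..T} \<Longrightarrow> dist s p < d \<Longrightarrow> dist (f s) (f p) < e / 2"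
      using f p e unfolding continuous_on_iff by (meson half_gt_zero)
    obtain N where N: "\<And>n. n \<ge> N \<Longrightarrow> \<delta> n < d / 3"
      using \<delta>_small[of "d / 3"] d(1) by (auto simp: eventually_sequentially)
    have "norm (integral {0..T} (\<lambda>s. f s * (tent ((s - c n) / \<delta> n) / \<delta> n)) - f p) < e" if n: "n \<ge> N" for n
    proof -
      have "\<bar>f s - f p\<bar> \<le> e / 2" if "c n \<le> s" "s \<le> c n + 2 * \<delta> n" for s
        using d(2)[of s] c(1,2)[of n] c(3)[OF that] N[OF n] that by (auto simp: dist_real_def)
      then have "\<bar>integral {0..T} (\<lambda>s. f s * (tent ((s - c n) / \<delta> n) / \<delta> n)) - f p\<bar> \<le> e / 2"
        using \<delta>(1) c by (intro tent_average f) auto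
      then show ?thesis using e by simp
    qed
    then show "\<exists>N. \<forall>n\<ge>N. norm (integral {0..T} (\<lambda>s. f s * (tent ((s - c n) / \<delta> n) / \<delta> n)) - f p) < e"
      by blast
  qed
  have "(\<lambda>n. integral {0..T} (\<lambda>s. f s * up n s)) \<longlonglongrightarrow> f 0"
    unfolding up_def
  proof (rule average)
    show "\<delta> n + 2 * \<delta> n \<le> T" for n using \<delta>[of n] t by simp
  qed (use \<delta> t in \<open>auto simp: less_imp_le\<close>)
  moreover have "(\<lambda>n. integral {0..T} (\<lambda>s. f s * down n s)) \<longlonglongrightarrow> f t"
    unfolding down_def
  proof (rule average)
    show "0 \<le> t - 3 * \<delta> n" "t - 3 * \<delta> n + 2 * \<delta> n \<le> T" for n using \<delta>[of n] t by simp_all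
    show "\<bar>s - t\<bar> \<le> 3 * \<delta> n" if "t - 3 * \<delta> n \<le> s" "s \<le> t - 3 * \<delta> n + 2 * \<delta> n" for n s
      using that \<delta>[of n] by linarith
  qed (use t in auto)
  ultimately have "(\<lambda>n. - (LINT s|lborel. h s * \<phi> n s)) \<longlonglongrightarrow> f 0 - f t"
    unfolding parts[symmetric] by (rule tendsto_diff)
  moreover have "(\<lambda>n. - (LINT s|lborel. h s * \<phi> n s)) \<longlonglongrightarrow> - (LINT s|lborel. indicator {..t} s * h s)"
  proof (rule tendsto_minus, rule integral_dominated_convergence[where w = "\<lambda>s. \<bar>h s\<bar>"])
    have "\<phi> n \<in> borel_measurable borel" for n
      unfolding \<phi>_def smooth_step_def by measurable
    then show "(\<lambda>s. h s * \<phi> n s) \<in> borel_measurable lborel" for n by simp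
    show "(\<lambda>s. indicator {..t} s * h s) \<in> borel_measurable lborel" by simp
    show "integrable lborel (\<lambda>s. \<bar>h s\<bar>)" using h by simp
    show "AE s in lborel. norm (h s * \<phi> n s) \<le> \<bar>h s\<bar>" for n
    proof (rule AE_I2)
      fix s
      have "\<bar>\<phi> n s\<bar> \<le> 1"
        using smooth_step_range[of "(s - \<delta> n) / \<delta> n"] smooth_step_range[of "(s - (t - 3 * \<delta> n)) / \<delta> n"]
        unfolding \<phi>_def by linarith
      then show "norm (h s * \<phi> n s) \<le> \<bar>h s\<bar>"
        using mult_left_mono[of "\<bar>\<phi> n s\<bar>" 1 "\<bar>h s\<bar>"] by (simp add: abs_mult)
    qed
    have "AE s in lborel. s \<noteq> t" by (rule AE_lborel_singleton)
    then show "AE s in lborel. (\<lambda>n. h s * \<phi> n s) \<longlonglongrightarrow> indicator {..t} s * h s"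
    proof eventually_elim
      case (elim s)
      consider "s \<le> 0" | "0 < s" "s < t" | "t < s" using elim by linarith
      then show ?case
      proof cases
        case 1
        then show ?thesis using h0[of s] by simp
      next
        case 2
        have "\<forall>\<^sub>F n in sequentially. h s * \<phi> n s = indicator {..t} s * h s"
        proof (rule eventually_elim2)
          show "\<forall>\<^sub>F n in sequentially. \<delta> n < s / 3" "\<forall>\<^sub>F n in sequentially. \<delta> n < (t - s) / 3"
            by (rule \<delta>_small, use 2 in simp)+
        next
          fix n assume "\<delta> n < s / 3" "\<delta> n < (t - s) / 3"
          then have "2 \<le> (s - \<delta> n) / \<delta> n" "(s - (t - 3 * \<delta> n)) / \<delta> n \<le> 0"
            using \<delta>[of n] 2 by (auto simp: pos_le_divide_eq divide_le_0_iff)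
          then show "h s * \<phi> n s = indicator {..t} s * h s" using 2 by (simp add: \<phi>_def smooth_step_eq)
        qed
        then show ?thesis by (rule tendsto_eventually)
      next
        case 3
        then have "\<phi> n s = 0" for n using \<delta>[of n] by (intro \<phi>_zero) auto
        then show ?thesis using 3 by simp
      qed
    qed
  qed
  ultimately have "f 0 - f t = - (LINT s|lborel. indicator {..t} s * h s)" by (rule LIMSEQ_unique)
  then show ?thesis by simp
qed

section \<open>Inversion of the Atangana-Baleanu derivative\<close>

text \<open>Fubini's theorem followed by a translation of the inner integral. The bound concerns
  only the points where \<open>h\<close> does not vanish; for \<open>h\<close> supported in a bounded time interval, local
  estimates of \<open>f\<close> and \<open>g\<close> therefore suffice.\<close>

lemma convolution_assoc:
  fixes f g h :: "real \<Rightarrow> real"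
  assumes [measurable]: "f \<in> borel_measurable borel" "g \<in> borel_measurable borel"
    and h: "integrable lborel h"
    and fg: "\<And>s. integrable lborel (\<lambda>r. f (t - s - r) * g r)"
    and bound: "\<And>s. h s \<noteq> 0 \<Longrightarrow> (LINT r|lborel. \<bar>f (t - s - r) * g r\<bar>) \<le> B"
  shows "(LINT r|lborel. f (t - r) * (LINT s|lborel. g (r - s) * h s))
       = (LINT s|lborel. (LINT r|lborel. f (t - s - r) * g r) * h s)"
proof -
  have hm [measurable]: "h \<in> borel_measurable borel" using borel_measurable_integrable[OF h] by simp
  define F where "F = (\<lambda>s r. f (t - r) * g (r - s) * h s)"
  have shift: "F s (s + r) = f (t - s - r) * g r * h s" for s r
    by (simp add: F_def algebra_simps)
  have int_F: "integrable lborel (F s)" for s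
    using fg[of s, THEN integrable_mult_left, of "h s"] lborel_integrable_real_affine_iff[of 1 "F s" s]
    by (simp add: shift)
  have norm_F: "(LINT r|lborel. norm (F s r)) = (LINT r|lborel. \<bar>f (t - s - r) * g r\<bar>) * \<bar>h s\<bar>" for s
    using lborel_integral_real_affine[of 1 "\<lambda>r. norm (F s r)" s]
    by (simp add: shift abs_mult)
  have "integrable (lborel \<Otimes>\<^sub>M lborel) (case_prod F)"
  proof (rule lborel_pair.Fubini_integrable)
    show "case_prod F \<in> borel_measurable (lborel \<Otimes>\<^sub>M lborel)" unfolding F_def by measurable
    show "AE s in lborel. integrable lborel (\<lambda>r. case_prod F (s, r))" using int_F by simp
    have "integrable lborel (\<lambda>s. LINT r|lborel. norm (F s r))"
    proof (rule Bochner_Integration.integrable_bound)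
      show "integrable lborel (\<lambda>s. B * \<bar>h s\<bar>)" using h by simp
      show "(\<lambda>s. LINT r|lborel. norm (F s r)) \<in> borel_measurable lborel" unfolding F_def by measurable
      show "AE s in lborel. norm (LINT r|lborel. norm (F s r)) \<le> norm (B * \<bar>h s\<bar>)"
      proof (rule AE_I2)
        fix s
        show "norm (LINT r|lborel. norm (F s r)) \<le> norm (B * \<bar>h s\<bar>)"
        proof (cases "h s = 0")
          case False
          have "0 \<le> (LINT r|lborel. \<bar>f (t - s - r) * g r\<bar>)" by (rule Bochner_Integration.integral_nonneg) simp
          with bound[OF False] show ?thesis unfolding norm_F by (simp add: abs_mult mult_right_mono)
        next
          case True
          then show ?thesis unfolding norm_F by simp
        qed
      qed
    qed
    then show "integrable lborel (\<lambda>s. LINT r|lborel. norm (case_prod F (s, r)))" by simp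
  qed
  from lborel_pair.Fubini_integral[OF this]
  have "(LINT r|lborel. LINT s|lborel. F s r) = (LINT s|lborel. LINT r|lborel. F s r)" .
  moreover have "(LINT r|lborel. F s r) = (LINT r|lborel. f (t - s - r) * g r) * h s" for s
    using lborel_integral_real_affine[of 1 "F s" s] by (simp add: shift)
  moreover have "(LINT s|lborel. F s r) = f (t - r) * (LINT s|lborel. g (r - s) * h s)" for r
    by (simp add: F_def mult.assoc)
  ultimately show ?thesis by simp
qed

text \<open>The jump of the kernel at \<open>0\<close> meets the integrand in the single point \<open>s = t\<close>, so dominated
  convergence still gives continuity in \<open>t\<close>.\<close>

lemma relaxation_convolution_continuous:
  assumes g: "0 < \<gamma>" and h: "integrable lborel h" and h0: "\<And>s. s \<le> 0 \<Longrightarrow> h s = 0"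
  shows "integrable lborel (\<lambda>s. relaxation_kernel \<gamma> c (t - s) * h s)"
    and "continuous_on {0..T} (\<lambda>t. LINT s|lborel. relaxation_kernel \<gamma> c (t - s) * h s)"
proof -
  note [measurable] = relaxation_kernel_measurable[OF g]
  have hm [measurable]: "h \<in> borel_measurable borel" using borel_measurable_integrable[OF h] by simp
  have dom: "\<exists>M. \<forall>t\<le>T. \<forall>s. norm (relaxation_kernel \<gamma> c (t - s) * h s) \<le> M * \<bar>h s\<bar>" for T
  proof -
    obtain M where M: "\<And>t. t \<le> T \<Longrightarrow> \<bar>relaxation_kernel \<gamma> c t\<bar> \<le> M"
      using relaxation_kernel_bounded[OF g, of T c] by metis
    have "norm (relaxation_kernel \<gamma> c (t - s) * h s) \<le> M * \<bar>h s\<bar>" if "t \<le> T" for t s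
    proof (cases "s \<le> 0")
      case False
      then show ?thesis using M[of "t - s"] that by (simp add: abs_mult mult_right_mono)
    qed (simp add: h0)
    then show ?thesis by blast
  qed
  show "integrable lborel (\<lambda>s. relaxation_kernel \<gamma> c (t - s) * h s)"
  proof -
    obtain M where M: "\<And>s. norm (relaxation_kernel \<gamma> c (t - s) * h s) \<le> M * \<bar>h s\<bar>"
      using dom[of t] by blast
    show ?thesis
    proof (rule Bochner_Integration.integrable_bound)
      show "integrable lborel (\<lambda>s. M * \<bar>h s\<bar>)" using h by simp
      show "AE s in lborel. norm (relaxation_kernel \<gamma> c (t - s) * h s) \<le> norm (M * \<bar>h s\<bar>)"
        using M by (intro AE_I2) (metis abs_ge_self order_trans real_norm_def)
    qed simp
  qed
  obtain M where M: "\<And>t s. t \<le> T \<Longrightarrow> norm (relaxation_kernel \<gamma> c (t - s) * h s) \<le> M * \<bar>h s\<bar>"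
    using dom[of T] by blast
  show "continuous_on {0..T} (\<lambda>t. LINT s|lborel. relaxation_kernel \<gamma> c (t - s) * h s)"
    unfolding continuous_on_sequentially comp_def
  proof (intro allI ballI impI)
    fix x :: "nat \<Rightarrow> real" and t assume x: "(\<forall>n. x n \<in> {0..T}) \<and> x \<longlonglongrightarrow> t"
    show "(\<lambda>n. LINT s|lborel. relaxation_kernel \<gamma> c (x n - s) * h s)
        \<longlonglongrightarrow> (LINT s|lborel. relaxation_kernel \<gamma> c (t - s) * h s)"
    proof (rule integral_dominated_convergence)
      show "integrable lborel (\<lambda>s. M * \<bar>h s\<bar>)" using h by simp
      show "AE s in lborel. norm (relaxation_kernel \<gamma> c (x n - s) * h s) \<le> M * \<bar>h s\<bar>" for n
        using x by (intro AE_I2 M) auto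
      show "AE s in lborel. (\<lambda>n. relaxation_kernel \<gamma> c (x n - s) * h s)
          \<longlonglongrightarrow> relaxation_kernel \<gamma> c (t - s) * h s"
        using AE_lborel_singleton[of t]
      proof eventually_elim
        case (elim s)
        have "(\<lambda>n. relaxation_kernel \<gamma> c (x n - s)) \<longlonglongrightarrow> relaxation_kernel \<gamma> c (t - s)"
          by (rule isCont_tendsto_compose[OF isCont_relaxation_kernel[OF g]])
             (use elim x in \<open>auto intro!: tendsto_intros\<close>)
        then show ?case by (intro tendsto_intros)
      qed
    qed simp_all
  qed
qed

text \<open>The Atangana-Baleanu derivative is the convolution of \<open>f'\<close> with the relaxation kernel, divided by
  \<open>1 - \<gamma>\<close>. With \<open>c = \<gamma> / (1 - \<gamma>)\<close>, the convolution of \<open>rl_kernel \<gamma>\<close> with the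
  relaxation kernel \<open>K\<close> is \<open>(1 - K) / c\<close> on positive times. Convolving this identity with
  \<open>f'\<close> shows that the operator \<open>(1 - \<gamma>) + \<gamma> I\<^sup>\<gamma>\<close>, with \<open>I\<^sup>\<gamma>\<close> the Riemann-Liouville integral,
  undoes the derivative up to the initial value.\<close>

lemma AB_derivative_W12:
  assumes g: "0 < \<gamma>" "\<gamma> < 1" and f: "continuous_on {0..T} f" and W: "sobolev_W12 T f"
  shows "continuous_on {0..T} (AB_derivative T \<gamma> f)"
    and "t \<in> {0..T} \<Longrightarrow>
      (1 - \<gamma>) * AB_derivative T \<gamma> f t + \<gamma> * rl_integral \<gamma> (AB_derivative T \<gamma> f) t = f t - f 0"
proof -
  obtain h where h: "integrable lborel h" "\<And>s. s \<notin> {0<..<T} \<Longrightarrow> h s = 0"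
    and AB: "\<And>k t. k \<in> borel_measurable borel \<Longrightarrow> t \<le> T \<Longrightarrow>
      (LINT s|lebesgue_on {0..t}. weak_derivative T f s * k s)
        = (LINT s|lborel. indicator {..t} s * (h s * k s))"
    and weak: "\<forall>\<phi> \<phi>'. (\<forall>s. (\<phi> has_real_derivative \<phi>' s) (at s)) \<longrightarrow> continuous_on UNIV \<phi>' \<longrightarrow>
      compact (closure {s. \<phi> s \<noteq> 0}) \<longrightarrow> closure {s. \<phi> s \<noteq> 0} \<subseteq> {0<..<T} \<longrightarrow>
      (LINT s|lebesgue_on {0<..<T}. f s * \<phi>' s) = - (LINT s|lborel. h s * \<phi> s)"
    by (rule W12_weak_derivative_representative[OF W]) (rule that)
  note [measurable] = relaxation_kernel_measurable[OF g(1)] mittag_leffler_measurable[OF g(1)]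
  have hm [measurable]: "h \<in> borel_measurable borel" using borel_measurable_integrable[OF h(1)] by simp
  define c where "c = \<gamma> / (1 - \<gamma>)"
  define K where "K = relaxation_kernel \<gamma> c"
  have Km [measurable]: "K \<in> borel_measurable borel" unfolding K_def by measurable
  define Q where "Q = (\<lambda>t. LINT s|lborel. K (t - s) * h s)"
  have Q_int: "integrable lborel (\<lambda>s. K (t - s) * h s)" for t
    unfolding K_def by (rule relaxation_convolution_continuous[OF g(1) h(1)]) (simp add: h(2))
  have AB_eq: "AB_derivative T \<gamma> f t = Q t / (1 - \<gamma>)" if "t \<le> T" for t
  proof -
    let ?k = "\<lambda>s. mittag_leffler \<gamma> 1 (- \<gamma> * ((t - s) powr \<gamma> / (1 - \<gamma>)))"
    have "(LINT s|lborel. indicator {..t} s * (h s * ?k s)) = Q t"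
      unfolding Q_def
    proof (rule integral_cong_AE)
      show "AE s in lborel. indicator {..t} s * (h s * ?k s) = K (t - s) * h s"
        using AE_lborel_singleton[of t]
        by eventually_elim (auto simp: indicator_def K_def relaxation_kernel_def c_def)
    qed simp_all
    then show ?thesis using AB[of ?k t] that by (simp add: AB_derivative_def)
  qed
  have "continuous_on {0..T} (\<lambda>t. Q t / (1 - \<gamma>))"
    unfolding Q_def K_def using g h(2)
    by (intro continuous_on_divide relaxation_convolution_continuous continuous_on_const h) auto
  then show "continuous_on {0..T} (AB_derivative T \<gamma> f)"
    by (rule continuous_on_eq) (simp add: AB_eq)
  assume t: "t \<in> {0..T}"
  obtain M where M: "\<And>t. t \<le> T \<Longrightarrow> \<bar>K t\<bar> \<le> M"
    using relaxation_kernel_bounded[OF g(1), of T c] unfolding K_def by metis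
  have "rl_integral \<gamma> (AB_derivative T \<gamma> f) t
      = (LINT r|lborel. rl_kernel \<gamma> (t - r) * Q r / (1 - \<gamma>))"
    unfolding rl_integral_def
  proof (rule Bochner_Integration.integral_cong[OF refl])
    fix r
    consider "r < 0" | "t < r" | "r \<in> {0..t}" by fastforce
    then show "indicator {0..t} r * (rl_kernel \<gamma> (t - r) * AB_derivative T \<gamma> f r)
        = rl_kernel \<gamma> (t - r) * Q r / (1 - \<gamma>)"
    proof cases
      case 1
      have "K (r - s) * h s = 0" for s
        using 1 h(2)[of s] by (cases "s \<le> 0") (auto simp: K_def relaxation_kernel_def)
      then have "Q r = 0" unfolding Q_def by (simp only: Bochner_Integration.integral_zero)
      then show ?thesis using 1 by simp
    next
      case 3
      then show ?thesis using t by (simp add: AB_eq)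
    qed (simp add: rl_kernel_eq_0)
  qed
  also have "\<dots> = (LINT r|lborel. rl_kernel \<gamma> (t - r) * Q r) / (1 - \<gamma>)" by simp
  also have "(LINT r|lborel. rl_kernel \<gamma> (t - r) * Q r)
      = (LINT s|lborel. (LINT r|lborel. rl_kernel \<gamma> (t - s - r) * K r) * h s)"
    unfolding Q_def
  proof (rule convolution_assoc[OF _ _ h(1)])
    show "integrable lborel (\<lambda>r. rl_kernel \<gamma> (t - s - r) * K r)" for s
      unfolding K_def by (rule rl_kernel_convolution_relaxation[OF g(1)])
    fix s assume "h s \<noteq> 0"
    then have s: "0 < s" "s < T" using h(2)[of s] by auto
    have "(LINT r|lborel. \<bar>rl_kernel \<gamma> (t - s - r) * K r\<bar>)
        \<le> (LINT r|lborel. M * (rl_kernel \<gamma> (t - s - r) * rl_kernel 1 r))"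
    proof (rule Bochner_Integration.integral_mono)
      show "integrable lborel (\<lambda>r. \<bar>rl_kernel \<gamma> (t - s - r) * K r\<bar>)"
        unfolding K_def by (intro integrable_abs rl_kernel_convolution_relaxation[OF g(1)])
      show "integrable lborel (\<lambda>r. M * (rl_kernel \<gamma> (t - s - r) * rl_kernel 1 r))"
        using g by (intro integrable_mult_right rl_kernel_convolution) auto
      fix r
      show "\<bar>rl_kernel \<gamma> (t - s - r) * K r\<bar> \<le> M * (rl_kernel \<gamma> (t - s - r) * rl_kernel 1 r)"
      proof (cases "0 < r \<and> r < t - s")
        case True
        then have "\<bar>K r\<bar> * rl_kernel \<gamma> (t - s - r) \<le> M * rl_kernel \<gamma> (t - s - r)"
          using t s by (intro mult_right_mono M rl_kernel_nonneg g) auto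
        then show ?thesis using True rl_kernel_nonneg[OF g(1), of "t - s - r"]
          by (simp add: rl_kernel_1 abs_mult mult.commute)
      qed (auto simp: rl_kernel_eq_0 K_def relaxation_kernel_def)
    qed
    also have "\<dots> = M * rl_kernel (\<gamma> + 1) (t - s)"
      using rl_kernel_convolution(2)[OF g(1), of 1 "t - s"] by simp
    also have "\<dots> \<le> M * (T powr \<gamma> / Gamma (\<gamma> + 1))"
    proof (rule mult_left_mono)
      show "0 \<le> M" using M[of T] by simp
      have "Gamma (\<gamma> + 1) > 0" using g by (intro Gamma_real_pos) auto
      then show "rl_kernel (\<gamma> + 1) (t - s) \<le> T powr \<gamma> / Gamma (\<gamma> + 1)"
        using s t g by (auto simp: rl_kernel_def intro!: divide_right_mono powr_mono2)
    qed
    finally show "(LINT r|lborel. \<bar>rl_kernel \<gamma> (t - s - r) * K r\<bar>)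
        \<le> M * (T powr \<gamma> / Gamma (\<gamma> + 1))" .
  qed simp_all
  finally have "\<gamma> * rl_integral \<gamma> (AB_derivative T \<gamma> f) t
      = c * (LINT s|lborel. (LINT r|lborel. rl_kernel \<gamma> (t - s - r) * K r) * h s)"
    by (simp add: c_def)
  also have "\<dots> = (LINT s|lborel. c * (LINT r|lborel. rl_kernel \<gamma> (t - s - r) * K r) * h s)"
    by (subst mult.assoc) (simp only: integral_mult_right_zero)
  also have "\<dots> = (LINT s|lborel. rl_kernel 1 (t - s) * h s - K (t - s) * h s)"
    using rl_kernel_convolution_relaxation(2)[OF g(1), of c] by (simp add: K_def left_diff_distrib)
  also have "\<dots> = (LINT s|lborel. rl_kernel 1 (t - s) * h s) - Q t"
  proof -
    have "integrable lborel (\<lambda>s. rl_kernel 1 (t - s) * h s)"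
      by (rule Bochner_Integration.integrable_bound[OF h(1)]) (auto simp: rl_kernel_1)
    then show ?thesis unfolding Q_def by (intro Bochner_Integration.integral_diff Q_int)
  qed
  also have "(LINT s|lborel. rl_kernel 1 (t - s) * h s) = (LINT s|lborel. indicator {..t} s * h s)"
  proof (rule integral_cong_AE)
    show "AE s in lborel. rl_kernel 1 (t - s) * h s = indicator {..t} s * h s"
      using AE_lborel_singleton[of t] by eventually_elim (auto simp: rl_kernel_1 indicator_def)
  qed simp_all
  also have "\<dots> = f t - f 0"
  proof (cases "t = 0")
    case True
    have "(\<lambda>s. indicator {..t} s * h s) = (\<lambda>s. 0)"
      using True h(2) by (auto simp: indicator_def)
    then show ?thesis using True by simp
  next
    case False
    then show ?thesis using t by (intro du_Bois_Reymond[OF f h weak]) auto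
  qed
  finally show "(1 - \<gamma>) * AB_derivative T \<gamma> f t + \<gamma> * rl_integral \<gamma> (AB_derivative T \<gamma> f) t = f t - f 0"
    using AB_eq[of t] t g by simp
qed

section \<open>Stability of the fractional Volterra equation\<close>

text \<open>The Laplace transform of the kernel tends to zero at infinity; this makes fractional integration a
  contraction in a sufficiently strong exponential weight.\<close>

lemma rl_kernel_Laplace_tendsto_0:
  assumes a: "a > 0"
  shows "(\<lambda>n. LINT s|lborel. indicator {0..T} s * rl_kernel a s * exp (- real n * s)) \<longlonglongrightarrow> 0"
proof -
  have int: "integrable lborel (\<lambda>s. indicator {0..T} s * rl_kernel a s)"
  proof -
    have "integrable lborel (\<lambda>s. indicator {0..} (T + (-1) * s) * rl_kernel a (T - (T + (-1) * s)))"
      by (rule lborel_integrable_real_affine[OF rl_kernel_integral_from(1)[OF a]]) simp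
    moreover have "indicator {0..} (T + (-1) * s) * rl_kernel a (T - (T + (-1) * s)) = indicator {0..T} s * rl_kernel a s" for s
      by (auto simp: indicator_def rl_kernel_def)
    ultimately show ?thesis by (simp only:)
  qed
  have "(\<lambda>n. LINT s|lborel. indicator {0..T} s * rl_kernel a s * exp (- real n * s)) \<longlonglongrightarrow> (LINT s|(lborel :: real measure). 0)"
  proof (rule integral_dominated_convergence)
    show "integrable lborel (\<lambda>s. indicator {0..T} s * rl_kernel a s)" by (rule int)
    show "AE s in lborel. norm (indicator {0..T} s * rl_kernel a s * exp (- real n * s)) \<le> indicator {0..T} s * rl_kernel a s" for n
    proof (rule AE_I2)
      fix s :: real
      have "indicator {0..T} s * rl_kernel a s * exp (- real n * s) \<le> indicator {0..T} s * rl_kernel a s * 1"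
        if "s \<ge> 0" using that rl_kernel_nonneg[OF a] by (intro mult_left_mono) auto
      then show "norm (indicator {0..T} s * rl_kernel a s * exp (- real n * s)) \<le> indicator {0..T} s * rl_kernel a s"
        using rl_kernel_nonneg[OF a, of s] by (cases "s \<ge> 0") (auto simp: abs_mult)
    qed
    show "AE s in lborel. (\<lambda>n. indicator {0..T} s * rl_kernel a s * exp (- real n * s)) \<longlonglongrightarrow> 0"
    proof (rule AE_I2)
      fix s :: real
      show "(\<lambda>n. indicator {0..T} s * rl_kernel a s * exp (- real n * s)) \<longlonglongrightarrow> 0"
      proof (cases "s > 0")
        case True
        have "(\<lambda>n. exp (- s) ^ n) \<longlonglongrightarrow> 0" using True by (intro LIMSEQ_realpow_zero) auto
        then have "(\<lambda>n. exp (- real n * s)) \<longlonglongrightarrow> 0" by (simp add: exp_of_nat_mult[symmetric])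
        then show ?thesis by (rule tendsto_mult_right_zero)
      qed (simp add: rl_kernel_eq_0)
    qed
  qed simp_all
  then show ?thesis by simp
qed

text \<open>Measure \<open>V\<close> in the norm \<open>max exp (- n * t) * \<bar>V t\<bar>\<close>. For large \<open>n\<close> the term
  \<open>\<beta> * rl_integral \<gamma> V\<close> is at most \<open>\<alpha> / 2\<close> times this norm and is absorbed by \<open>\<alpha> * V\<close>.
  The constant depends on the equation and the time interval alone, so estimates that are uniform in a parameter of the
  right-hand side carry over to the solution.\<close>

lemma Volterra_stability:
  assumes \<gamma>: "\<gamma> > 0" and \<alpha>: "\<alpha> > 0" and \<beta>: "\<beta> \<ge> 0" and T: "T \<ge> 0"
  obtains C where "C > 0"
    and "\<And>V B t. continuous_on {0..T} V \<Longrightarrow>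
      (\<And>t. t \<in> {0..T} \<Longrightarrow> \<bar>\<alpha> * V t + \<beta> * rl_integral \<gamma> V t\<bar> \<le> B) \<Longrightarrow> t \<in> {0..T} \<Longrightarrow> \<bar>V t\<bar> \<le> C * B"
proof -
  define \<Phi> where "\<Phi> = (\<lambda>n s. indicator {0..T} s * rl_kernel \<gamma> s * exp (- real n * s))"
  have lim: "(\<lambda>n. \<beta> * integral\<^sup>L lborel (\<Phi> n)) \<longlonglongrightarrow> 0"
    unfolding \<Phi>_def by (rule tendsto_mult_right_zero, rule rl_kernel_Laplace_tendsto_0, rule \<gamma>)
  \<comment> \<open>The weight exponent for which the integral term is at most half of the leading term.\<close>
  obtain n where n: "\<beta> * integral\<^sup>L lborel (\<Phi> n) \<le> \<alpha> / 2"
    using order_tendstoD(2)[OF lim, of "\<alpha> / 2"] \<alpha> by (auto simp: eventually_sequentially intro: less_imp_le)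
  define q where "q = integral\<^sup>L lborel (\<Phi> n)"
  show thesis
  proof (rule that)
    show "2 / \<alpha> * exp (real n * T) > 0" using \<alpha> by simp
    fix V B t
    assume V: "continuous_on {0..T} V"
      and w: "\<And>t. t \<in> {0..T} \<Longrightarrow> \<bar>\<alpha> * V t + \<beta> * rl_integral \<gamma> V t\<bar> \<le> B" and t: "t \<in> {0..T}"
    have "continuous_on {0..T} (\<lambda>t. exp (- real n * t) * \<bar>V t\<bar>)" by (intro continuous_intros V)
    then obtain r where r: "r \<in> {0..T}"
      and max: "\<And>t. t \<in> {0..T} \<Longrightarrow> exp (- real n * t) * \<bar>V t\<bar> \<le> exp (- real n * r) * \<bar>V r\<bar>"
      using continuous_attains_sup[of "{0..T}" "\<lambda>t. exp (- real n * t) * \<bar>V t\<bar>"] T by auto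
    have V_le: "\<bar>V s\<bar> \<le> exp (real n * (s - r)) * \<bar>V r\<bar>" if "s \<in> {0..T}" for s
    proof -
      have "\<bar>V s\<bar> = exp (real n * s) * (exp (- real n * s) * \<bar>V s\<bar>)" by (simp add: exp_minus)
      also have "\<dots> \<le> exp (real n * s) * (exp (- real n * r) * \<bar>V r\<bar>)"
        using max[OF that] by (intro mult_left_mono) auto
      also have "\<dots> = exp (real n * (s - r)) * \<bar>V r\<bar>"
        by (simp add: right_diff_distrib exp_diff exp_minus divide_inverse)
      finally show ?thesis .
    qed
    have [measurable]: "(\<lambda>s. indicator {0..r} s * V s) \<in> borel_measurable borel"
      using borel_measurable_continuous_on_indicator[of "{0..r}" V] continuous_on_subset[OF V, of "{0..r}"] r by simp
    have \<Phi>_int: "integrable lborel (\<lambda>s. \<Phi> n (r - s))"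
    proof (rule Bochner_Integration.integrable_bound)
      show "integrable lborel (\<lambda>s. indicator {r - T..} s * rl_kernel \<gamma> (r - s))"
        by (rule rl_kernel_integral_from[OF \<gamma>])
      show "(\<lambda>s. \<Phi> n (r - s)) \<in> borel_measurable lborel" unfolding \<Phi>_def by measurable
      show "AE s in lborel. norm (\<Phi> n (r - s)) \<le> norm (indicator {r - T..} s * rl_kernel \<gamma> (r - s))"
      proof (rule AE_I2)
        fix s
        have "rl_kernel \<gamma> (r - s) * exp (- real n * (r - s)) \<le> rl_kernel \<gamma> (r - s) * 1" if "s \<le> r"
          using that rl_kernel_nonneg[OF \<gamma>] by (intro mult_left_mono) (auto simp: mult_nonneg_nonneg)
        then show "norm (\<Phi> n (r - s)) \<le> norm (indicator {r - T..} s * rl_kernel \<gamma> (r - s))"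
          using rl_kernel_nonneg[OF \<gamma>, of "r - s"] by (auto simp: \<Phi>_def indicator_def abs_mult)
      qed
    qed
    have "\<bar>rl_integral \<gamma> V r\<bar> \<le> (LINT s|lborel. \<bar>indicator {0..r} s * (rl_kernel \<gamma> (r - s) * V s)\<bar>)"
      unfolding rl_integral_def by (rule integral_abs_bound)
    also have "\<dots> \<le> (LINT s|lborel. \<Phi> n (r - s) * \<bar>V r\<bar>)"
    proof (rule Bochner_Integration.integral_mono)
      show "integrable lborel (\<lambda>s. \<bar>indicator {0..r} s * (rl_kernel \<gamma> (r - s) * V s)\<bar>)"
        using continuous_on_subset[OF V, of "{0..r}"] r by (intro integrable_abs rl_integral_integrable \<gamma>) auto
      show "integrable lborel (\<lambda>s. \<Phi> n (r - s) * \<bar>V r\<bar>)" using \<Phi>_int by simp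
      fix s
      show "\<bar>indicator {0..r} s * (rl_kernel \<gamma> (r - s) * V s)\<bar> \<le> \<Phi> n (r - s) * \<bar>V r\<bar>"
      proof (cases "s \<in> {0..r}")
        case True
        have "rl_kernel \<gamma> (r - s) * \<bar>V s\<bar> \<le> rl_kernel \<gamma> (r - s) * (exp (real n * (s - r)) * \<bar>V r\<bar>)"
          using True r by (intro mult_left_mono V_le rl_kernel_nonneg \<gamma>) auto
        moreover have "real n * (s - r) = - real n * (r - s)" by (simp add: algebra_simps)
        ultimately show ?thesis using True r rl_kernel_nonneg[OF \<gamma>, of "r - s"]
          by (simp add: \<Phi>_def abs_mult mult.assoc)
      next
        case False
        then show ?thesis using rl_kernel_nonneg[OF \<gamma>, of "r - s"] by (simp add: \<Phi>_def)
      qed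
    qed
    also have "\<dots> = q * \<bar>V r\<bar>"
      using lborel_integral_real_affine[of "-1" "\<Phi> n" r] by (simp add: q_def)
    finally have "\<beta> * \<bar>rl_integral \<gamma> V r\<bar> \<le> \<beta> * q * \<bar>V r\<bar>"
      using \<beta> by (metis mult.assoc mult_left_mono)
    also have "\<dots> \<le> \<alpha> / 2 * \<bar>V r\<bar>" using n by (intro mult_right_mono) (auto simp: q_def)
    finally have "\<bar>\<beta> * rl_integral \<gamma> V r\<bar> \<le> \<alpha> / 2 * \<bar>V r\<bar>" using \<beta> by (simp add: abs_mult)
    moreover have "\<alpha> * \<bar>V r\<bar> = \<bar>\<alpha> * V r\<bar>" using \<alpha> by (simp add: abs_mult)
    ultimately have Vr: "\<alpha> / 2 * \<bar>V r\<bar> \<le> B" using w[OF r] by simp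
    have "\<bar>V t\<bar> \<le> exp (real n * (t - r)) * \<bar>V r\<bar>" by (rule V_le[OF t])
    also have "\<dots> \<le> exp (real n * T) * \<bar>V r\<bar>"
      using t r by (intro mult_right_mono) (auto intro!: mult_left_mono)
    also have "\<dots> \<le> exp (real n * T) * (2 / \<alpha> * B)"
      using Vr \<alpha> by (intro mult_left_mono) (auto simp: field_simps)
    finally show "\<bar>V t\<bar> \<le> 2 / \<alpha> * exp (real n * T) * B" by (simp add: mult_ac)
  qed
qed

section \<open>Extremum principles in space and time\<close>

lemma second_derivative_nonpos_at_local_maximum:
  assumes "has_second_derivative_at f d x" and "\<forall>\<^sub>F y in nhds x. f y \<le> f x"
  shows "d \<le> 0"
proof (rule ccontr)
  assume d: "\<not> d \<le> 0"
  obtain f' where f': "\<forall>\<^sub>F y in nhds x. (f has_real_derivative f' y) (at y)"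
    and f'': "(f' has_real_derivative d) (at x)"
    using assms(1) by (auto simp: has_second_derivative_at_def)
  obtain e where e: "e > 0"
    and near: "\<And>y. dist y x < e \<Longrightarrow> (f has_real_derivative f' y) (at y) \<and> f y \<le> f x"
    using eventually_conj[OF f' assms(2)] by (auto simp: eventually_nhds_metric)
  have "f' x = 0"
    using near e by (intro DERIV_local_max[of f "f' x" x e]) (auto simp: dist_real_def abs_minus_commute)
  then obtain e' where e': "e' > 0" "\<And>h. 0 < h \<Longrightarrow> h < e' \<Longrightarrow> 0 < f' (x + h)"
    using DERIV_pos_inc_right[OF f''] d by auto
  define h where "h = min e e' / 2"
  have h: "0 < h" "h < e" "h < e'" using e e' by (auto simp: h_def)
  have "\<exists>z>x. z < x + h \<and> f (x + h) - f x = (x + h - x) * f' z"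
    using near h by (intro MVT2) (auto simp: dist_real_def)
  then obtain z where z: "x < z" "z < x + h" "f (x + h) - f x = h * f' z" by auto
  then have "0 < f' z" using e'(2)[of "z - x"] h by simp
  then have "0 < h * f' z" using h by simp
  then have "f x < f (x + h)" using z(3) by simp
  moreover have "f (x + h) \<le> f x" using near[of "x + h"] h by (simp add: dist_real_def)
  ultimately show False by simp
qed

lemma has_second_derivative_at_diff:
  assumes "has_second_derivative_at f d x" and "has_second_derivative_at g e x"
  shows "has_second_derivative_at (\<lambda>y. f y - g y) (d - e) x"
proof -
  obtain f' g' where f': "\<forall>\<^sub>F y in nhds x. (f has_real_derivative f' y) (at y)" "(f' has_real_derivative d) (at x)"
    and g': "\<forall>\<^sub>F y in nhds x. (g has_real_derivative g' y) (at y)" "(g' has_real_derivative e) (at x)"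
    using assms by (auto simp: has_second_derivative_at_def)
  have "\<forall>\<^sub>F y in nhds x. ((\<lambda>y. f y - g y) has_real_derivative f' y - g' y) (at y)"
    using f'(1) g'(1) by eventually_elim (rule DERIV_diff)
  moreover have "((\<lambda>y. f' y - g' y) has_real_derivative d - e) (at x)"
    using f'(2) g'(2) by (rule DERIV_diff)
  ultimately show ?thesis unfolding has_second_derivative_at_def
    by (intro exI[of _ "\<lambda>y. f' y - g' y"]) simp
qed

text \<open>On \<open>[0, t]\<close> the kernel for the later time \<open>t0\<close> is the smaller one, because it is decreasing, and
  \<open>g\<close> is nonnegative; so that part contributes nothing positive. On \<open>[t, t0]\<close> the function is at
  most \<open>g t\<close>, and the kernel integrates to \<open>rl_kernel (\<gamma> + 1) (t0 - t)\<close>.\<close>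

lemma rl_integral_increment_le:
  assumes \<gamma>: "0 < \<gamma>" "\<gamma> \<le> 1" and t: "0 \<le> t" "t \<le> t0"
    and g: "continuous_on {0..t0} g" and nonneg: "\<And>s. s \<in> {0..t0} \<Longrightarrow> 0 \<le> g s"
    and le: "\<And>s. s \<in> {t..t0} \<Longrightarrow> g s \<le> g t"
  shows "rl_integral \<gamma> g t0 - rl_integral \<gamma> g t \<le> g t * rl_kernel (\<gamma> + 1) (t0 - t)"
proof -
  let ?I = "\<lambda>t s. indicator {0..t} s * (rl_kernel \<gamma> (t - s) * g s)"
  have int: "integrable lborel (?I t0)" "integrable lborel (?I t)"
    using continuous_on_subset[OF g, of "{0..t}"] g t \<gamma> by (auto intro!: rl_integral_integrable)
  have gt: "0 \<le> g t" using nonneg[of t] t by simp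
  have "rl_integral \<gamma> g t0 - rl_integral \<gamma> g t = (LINT s|lborel. ?I t0 s - ?I t s)"
    unfolding rl_integral_def using int by simp
  also have "\<dots> \<le> (LINT s|lborel. g t * (indicator {t..} s * rl_kernel \<gamma> (t0 - s)))"
  proof (rule Bochner_Integration.integral_mono)
    show "integrable lborel (\<lambda>s. ?I t0 s - ?I t s)" using int by simp
    show "integrable lborel (\<lambda>s. g t * (indicator {t..} s * rl_kernel \<gamma> (t0 - s)))"
      by (intro integrable_mult_right rl_kernel_integral_from \<gamma>)
    fix s
    consider "s < 0" | "0 \<le> s" "s < t" | "t \<le> s" "s \<le> t0" | "t0 < s" using t by linarith
    then show "?I t0 s - ?I t s \<le> g t * (indicator {t..} s * rl_kernel \<gamma> (t0 - s))"
    proof cases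
      case 2
      have "rl_kernel \<gamma> (t0 - s) \<le> rl_kernel \<gamma> (t - s)"
        using 2 t \<gamma> Gamma_real_pos[OF \<gamma>(1)]
        by (auto simp: rl_kernel_def intro!: divide_right_mono powr_mono2')
      then have "rl_kernel \<gamma> (t0 - s) * g s \<le> rl_kernel \<gamma> (t - s) * g s"
        using nonneg[of s] 2 t by (intro mult_right_mono) auto
      then show ?thesis using 2 t by simp
    next
      case 3
      have "rl_kernel \<gamma> (t0 - s) * g s \<le> rl_kernel \<gamma> (t0 - s) * g t"
        using le[of s] 3 by (intro mult_left_mono rl_kernel_nonneg \<gamma>) auto
      moreover have "?I t s = 0" using 3 by (auto simp: indicator_def rl_kernel_def)
      moreover have "?I t0 s = rl_kernel \<gamma> (t0 - s) * g s" "indicator {t..} s = (1 :: real)"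
        using 3 t by auto
      ultimately show ?thesis by (simp only: diff_zero mult_1 mult.commute[of "g t"])
    qed (use gt t in \<open>auto simp: rl_kernel_eq_0\<close>)
  qed
  also have "\<dots> = g t * rl_kernel (\<gamma> + 1) (t0 - t)"
    using rl_kernel_integral_from(2)[OF \<gamma>(1), of t t0] by simp
  finally show ?thesis .
qed

text \<open>The extremum principle in time. Put \<open>M = V t0\<close> and \<open>g = M - V \<ge> 0\<close>. The fractional integral of
  the constant \<open>M\<close> has a positive derivative at \<open>t0\<close>, so it suffices that \<open>w\<close> minus this term does
  not decrease between suitable times \<open>t0 - h\<close>, with \<open>h\<close> arbitrarily small, and \<open>t0\<close>. Its
  increment is \<open>\<alpha> * g (t0 - h)\<close> minus \<open>\<beta>\<close> times the increment of the fractional integral of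
  \<open>g\<close>. The latter could be of order \<open>h powr \<gamma>\<close>, which is much larger than \<open>h\<close>. If,
  however, \<open>t0 - h\<close> is a maximum point of \<open>g\<close> on \<open>[t0 - h, t0]\<close>, it is at most a constant times
  \<open>h powr \<gamma> * g (t0 - h)\<close> and for small \<open>h\<close> the first term dominates it, even
  if \<open>V\<close> is merely continuous.\<close>

lemma derivative_pos_at_positive_maximum:
  assumes \<gamma>: "0 < \<gamma>" "\<gamma> \<le> 1" and \<alpha>: "0 < \<alpha>" and \<beta>: "0 < \<beta>" and t0: "0 < t0" "t0 \<le> T"
    and V: "continuous_on {0..T} V" and pos: "0 < V t0" and max: "\<And>s. s \<in> {0..t0} \<Longrightarrow> V s \<le> V t0"
    and w: "\<And>t. t \<in> {0..T} \<Longrightarrow> w t = \<alpha> * V t + \<beta> * rl_integral \<gamma> V t"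
    and d: "(w has_real_derivative d) (at t0 within {0<..T})"
  shows "0 < d"
proof (rule ccontr)
  assume "\<not> 0 < d"
  define k where "k = rl_kernel (\<gamma> + 1)"
  define M where "M = V t0"
  define g where "g = (\<lambda>s. M - V s)"
  have G: "Gamma (\<gamma> + 1) > 0" using \<gamma> by (intro Gamma_real_pos) auto
  have Vc: "continuous_on {0..t} V" if "t \<le> t0" for t
    using continuous_on_subset[OF V, of "{0..t}"] that t0 by simp
  have gc: "continuous_on {0..t} g" if "t \<le> t0" for t
    unfolding g_def by (intro continuous_intros Vc that)
  have "((\<lambda>t. w t - \<beta> * M * k t) has_real_derivative d - \<beta> * M * rl_kernel \<gamma> t0) (at t0 within {0<..T})"
  proof (intro DERIV_diff d DERIV_cmult)
    have "((\<lambda>t. t powr \<gamma> / Gamma (\<gamma> + 1)) has_real_derivative \<gamma> * t0 powr (\<gamma> - 1) / Gamma (\<gamma> + 1)) (at t0)"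
      using t0 G by (auto intro!: derivative_eq_intros simp: powr_diff)
    moreover have "\<gamma> * t0 powr (\<gamma> - 1) / Gamma (\<gamma> + 1) = rl_kernel \<gamma> t0"
      using t0 \<gamma> Gamma_plus1[of \<gamma>] by (simp add: rl_kernel_def nonpos_Ints_def)
    ultimately have "((\<lambda>t. t powr \<gamma> / Gamma (\<gamma> + 1)) has_real_derivative rl_kernel \<gamma> t0) (at t0)"
      by simp
    then have "(k has_real_derivative rl_kernel \<gamma> t0) (at t0)"
      by (rule has_field_derivative_transform_within_open[where S = "{0<..}"])
         (use t0 in \<open>auto simp: k_def rl_kernel_def\<close>)
    then show "(k has_real_derivative rl_kernel \<gamma> t0) (at t0 within {0<..T})"
      by (rule has_field_derivative_at_within)
  qed
  moreover have "d - \<beta> * M * rl_kernel \<gamma> t0 < 0"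
  proof -
    have "rl_kernel \<gamma> t0 > 0" using t0 Gamma_real_pos[OF \<gamma>(1)] by (simp add: rl_kernel_def)
    then have "\<beta> * M * rl_kernel \<gamma> t0 > 0" using \<beta> pos by (simp add: M_def)
    then show ?thesis using \<open>\<not> 0 < d\<close> by simp
  qed
  ultimately obtain e where e: "e > 0"
    and decr: "\<And>h. 0 < h \<Longrightarrow> t0 - h \<in> {0<..T} \<Longrightarrow> h < e \<Longrightarrow>
      w t0 - \<beta> * M * k t0 < w (t0 - h) - \<beta> * M * k (t0 - h)"
    using has_real_derivative_neg_dec_left by blast
  \<comment> \<open>The solution \<open>h = p\<close> of \<open>\<beta> * k h = \<alpha>\<close>.\<close>
  define p where "p = (\<alpha> * Gamma (\<gamma> + 1) / \<beta>) powr (1 / \<gamma>)"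
  have p_pos: "p > 0" using \<alpha> \<beta> G by (simp add: p_def)
  have k_small: "\<beta> * k h \<le> \<alpha>" if "0 < h" "h \<le> p" for h
  proof -
    have "h powr \<gamma> \<le> p powr \<gamma>" using that \<gamma> by (intro powr_mono2) auto
    also have "\<dots> = \<alpha> * Gamma (\<gamma> + 1) / \<beta>" using \<alpha> \<beta> G \<gamma> by (simp add: p_def powr_powr)
    finally show ?thesis using that \<beta> G by (simp add: k_def rl_kernel_def field_simps)
  qed
  define \<eta> where "\<eta> = min (min (t0 / 2) (e / 2)) p"
  have \<eta>: "0 < \<eta>" "\<eta> < t0" "\<eta> < e" "\<eta> \<le> p" using t0 e p_pos by (auto simp: \<eta>_def)
  have g_nonneg: "0 \<le> g s" if "s \<in> {0..t0}" for s using max[OF that] by (simp add: g_def M_def)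
  have "continuous_on {t0 - \<eta>..t0} g" using continuous_on_subset[OF gc[of t0], of "{t0 - \<eta>..t0}"] \<eta> by simp
  then obtain s where s: "s \<in> {t0 - \<eta>..t0}" "\<And>r. r \<in> {t0 - \<eta>..t0} \<Longrightarrow> g r \<le> g s"
    using continuous_attains_sup[of "{t0 - \<eta>..t0}" g] \<eta> by auto
  \<comment> \<open>If the maximum \<open>s\<close> is \<open>t0\<close> itself, then \<open>g\<close> vanishes on the interval and every point is a maximum.\<close>
  obtain t where t: "t0 - \<eta> \<le> t" "t < t0" and g_max: "\<And>r. r \<in> {t..t0} \<Longrightarrow> g r \<le> g t"
  proof (cases "s = t0")
    case True
    have "g r \<le> g (t0 - \<eta>)" if "r \<in> {t0 - \<eta>..t0}" for r
      using s(2)[OF that] g_nonneg[of "t0 - \<eta>"] \<eta> True by (simp add: g_def M_def)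
    then show ?thesis using that[of "t0 - \<eta>"] \<eta> by simp
  next
    case False
    then show ?thesis using that[of s] s by auto
  qed
  have t_pos: "0 < t" using t \<eta> by simp
  have gt: "0 \<le> g t" using g_nonneg[of t] t t_pos by simp
  have split: "rl_integral \<gamma> V r = M * k r - rl_integral \<gamma> g r" if "r \<le> t0" for r
    using rl_integral_diff[of \<gamma> r "\<lambda>_. M" g] gc[OF that] rl_integral_const[of \<gamma> M r] \<gamma>
    by (simp add: g_def k_def)
  have "rl_integral \<gamma> g t0 - rl_integral \<gamma> g t \<le> g t * k (t0 - t)"
    unfolding k_def using \<gamma> t t_pos gc g_nonneg g_max by (intro rl_integral_increment_le) auto
  then have "\<beta> * (rl_integral \<gamma> g t0 - rl_integral \<gamma> g t) \<le> \<beta> * (g t * k (t0 - t))"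
    using \<beta> by (intro mult_left_mono) auto
  also have "\<dots> = g t * (\<beta> * k (t0 - t))" by simp
  also have "\<dots> \<le> g t * \<alpha>" using k_small[of "t0 - t"] t \<eta> gt by (intro mult_left_mono) auto
  finally have "\<alpha> * (V t0 - V t) - \<beta> * (rl_integral \<gamma> g t0 - rl_integral \<gamma> g t) \<ge> 0"
    by (simp add: g_def M_def algebra_simps)
  moreover have "w t0 - \<beta> * M * k t0 - (w t - \<beta> * M * k t)
      = \<alpha> * (V t0 - V t) - \<beta> * (rl_integral \<gamma> g t0 - rl_integral \<gamma> g t)"
    using w[of t0] w[of t] t t0 t_pos split[of t0] split[of t] by (simp add: algebra_simps)
  moreover have "w t0 - \<beta> * M * k t0 < w t - \<beta> * M * k t"
    using decr[of "t0 - t"] t \<eta> t0 t_pos by simp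
  ultimately show False by simp
qed

section \<open>Uniqueness of classical solutions\<close>

lemma continuous_on_slice:
  assumes "continuous_on (A \<times> B) (\<lambda>(x, t). f x t)" and "x \<in> A"
  shows "continuous_on B (f x)"
proof -
  have "continuous_on B (\<lambda>t. case (x, t) of (x, t) \<Rightarrow> f x t)"
    by (rule continuous_on_compose2[OF assms(1)]) (use assms(2) in \<open>auto intro!: continuous_intros\<close>)
  then show ?thesis by simp
qed

text \<open>Continuity in the second variable together with continuity in the first, uniform in the second,
  gives joint continuity.\<close>

lemma continuous_on_Times_uniform:
  fixes D :: "real \<Rightarrow> real \<Rightarrow> real"
  assumes cont: "\<And>x. x \<in> A \<Longrightarrow> continuous_on B (D x)"
    and unif: "\<And>x e. x \<in> A \<Longrightarrow> e > 0 \<Longrightarrow>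
      \<exists>d>0. \<forall>y\<in>A. dist y x < d \<longrightarrow> (\<forall>t\<in>B. dist (D y t) (D x t) < e)"
  shows "continuous_on (A \<times> B) (\<lambda>(x, t). D x t)"
  unfolding continuous_on_iff
proof (intro ballI allI impI)
  fix p and e :: real assume p: "p \<in> A \<times> B" and e: "0 < e"
  obtain x t where p_eq: "p = (x, t)" and x: "x \<in> A" and t: "t \<in> B" using p by auto
  obtain d1 where d1: "d1 > 0" "\<And>y s. y \<in> A \<Longrightarrow> dist y x < d1 \<Longrightarrow> s \<in> B \<Longrightarrow> dist (D y s) (D x s) < e / 2"
    using unif[OF x, of "e / 2"] e by auto
  obtain d2 where d2: "d2 > 0" "\<And>s. s \<in> B \<Longrightarrow> dist s t < d2 \<Longrightarrow> dist (D x s) (D x t) < e / 2"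
    using cont[OF x] t e unfolding continuous_on_iff by (meson half_gt_zero)
  show "\<exists>d>0. \<forall>z\<in>A \<times> B. dist z p < d \<longrightarrow> dist (case z of (y, s) \<Rightarrow> D y s) (case p of (y, s) \<Rightarrow> D y s) < e"
  proof (intro exI[of _ "min d1 d2"] conjI ballI impI)
    show "0 < min d1 d2" using d1 d2 by simp
    fix z assume "z \<in> A \<times> B" "dist z p < min d1 d2"
    then obtain y s where z: "z = (y, s)" "y \<in> A" "s \<in> B" "dist (y, s) (x, t) < min d1 d2"
      by (auto simp: p_eq)
    have "dist y x < d1" "dist s t < d2"
      using z(4) dist_fst_le[of "(y, s)" "(x, t)"] dist_snd_le[of "(y, s)" "(x, t)"] by auto
    then have "dist (D y s) (D x s) < e / 2" "dist (D x s) (D x t) < e / 2" using d1 d2 z by auto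
    then show "dist (case z of (y, s) \<Rightarrow> D y s) (case p of (y, s) \<Rightarrow> D y s) < e"
      using dist_triangle[of "D y s" "D x t" "D x s"] z by (simp add: p_eq)
  qed
qed

text \<open>The weak maximum principle for the difference \<open>D\<close> of the fractional derivatives. Extended by zero
  to \<open>x = 0\<close> and \<open>x = a\<close>, it solves the Volterra equation with right-hand side \<open>u - v\<close> for every
  \<open>x\<close>; stability transfers the uniform continuity of \<open>u - v\<close> in \<open>x\<close> to \<open>D\<close>, so \<open>D\<close> is
  jointly continuous up to the boundary and attains its maximum. A positive maximum is attained in
  the interior or at the final time, where the equation equates the positive time derivative of
  \<open>u - v\<close> with the nonpositive second space derivative of \<open>D\<close>.\<close>

lemma AB_derivative_solution_le:
  assumes a: "0 < a" and T: "0 < T" and \<alpha>: "0 < \<alpha>" "\<alpha> < 1"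
    and u: "classical_solution a T \<alpha> F \<phi> lam mu u" and v: "classical_solution a T \<alpha> F \<phi> lam mu v"
    and x: "x \<in> {0<..<a}" and t: "t \<in> {0..T}"
  shows "AB_derivative T (1 - \<alpha>) (u x) t \<le> AB_derivative T (1 - \<alpha>) (v x) t"
proof -
  define \<gamma> where "\<gamma> = 1 - \<alpha>"
  have \<gamma>: "0 < \<gamma>" "\<gamma> < 1" "1 - \<gamma> = \<alpha>" using \<alpha> by (auto simp: \<gamma>_def)
  define w where "w = (\<lambda>x t. u x t - v x t)"
  define D where "D = (\<lambda>x t. if x \<in> {0<..<a} then AB_derivative T \<gamma> (u x) t - AB_derivative T \<gamma> (v x) t else 0)"
  have u_cont: "continuous_on ({0..a} \<times> {0..T}) (\<lambda>(x, t). u x t)"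
    and v_cont: "continuous_on ({0..a} \<times> {0..T}) (\<lambda>(x, t). v x t)"
    using u v by (auto simp: classical_solution_def)
  have slice: "continuous_on {0..T} (f x)"
    if "continuous_on ({0..a} \<times> {0..T}) (\<lambda>(x, t). f x t)" "x \<in> {0..a}" for f :: "real \<Rightarrow> real \<Rightarrow> real" and x
    using that by (rule continuous_on_slice)
  have AB: "continuous_on {0..T} (AB_derivative T \<gamma> (f x))"
    "t \<in> {0..T} \<Longrightarrow> \<alpha> * AB_derivative T \<gamma> (f x) t + \<gamma> * rl_integral \<gamma> (AB_derivative T \<gamma> (f x)) t = f x t - f x 0"
    if f: "classical_solution a T \<alpha> F \<phi> lam mu f" and x: "x \<in> {0<..<a}" for f x t
  proof -
    have "continuous_on {0..T} (f x)" "sobolev_W12 T (f x)"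
      using f x by (auto simp: classical_solution_def intro!: slice)
    from AB_derivative_W12[OF \<gamma>(1,2) this]
    show "continuous_on {0..T} (AB_derivative T \<gamma> (f x))"
      "t \<in> {0..T} \<Longrightarrow> \<alpha> * AB_derivative T \<gamma> (f x) t + \<gamma> * rl_integral \<gamma> (AB_derivative T \<gamma> (f x)) t = f x t - f x 0"
      by (simp_all add: \<gamma>)
  qed
  have D_cont: "continuous_on {0..T} (D x)" for x
    using AB(1)[OF u] AB(1)[OF v]
    by (cases "x \<in> {0<..<a}") (auto simp: D_def intro!: continuous_intros)
  have D_eq: "\<alpha> * D x t + \<gamma> * rl_integral \<gamma> (D x) t = w x t" if x: "x \<in> {0..a}" and t: "t \<in> {0..T}" for x t
  proof (cases "x \<in> {0<..<a}")
    case True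
    have D_x: "D x = (\<lambda>t. AB_derivative T \<gamma> (u x) t - AB_derivative T \<gamma> (v x) t)"
      using True by (simp add: D_def)
    have sub: "{0..t} \<subseteq> {0..T}" using t by simp
    have "rl_integral \<gamma> (D x) t = rl_integral \<gamma> (AB_derivative T \<gamma> (u x)) t - rl_integral \<gamma> (AB_derivative T \<gamma> (v x)) t"
      unfolding D_x
      by (intro rl_integral_diff \<gamma> continuous_on_subset[OF AB(1)[OF u True] sub] continuous_on_subset[OF AB(1)[OF v True] sub])
    then have "\<gamma> * rl_integral \<gamma> (D x) t
        = \<gamma> * rl_integral \<gamma> (AB_derivative T \<gamma> (u x)) t - \<gamma> * rl_integral \<gamma> (AB_derivative T \<gamma> (v x)) t"
      by (simp only: right_diff_distrib)
    moreover have "\<alpha> * D x t = \<alpha> * AB_derivative T \<gamma> (u x) t - \<alpha> * AB_derivative T \<gamma> (v x) t"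
      by (simp only: D_x right_diff_distrib)
    moreover have "u x 0 = v x 0" using u v x by (simp add: classical_solution_def)
    ultimately show ?thesis using AB(2)[OF u True t] AB(2)[OF v True t]
      unfolding w_def by linarith
  next
    case False
    then have "x = 0 \<or> x = a" using x by auto
    then have "w x t = 0" using u v t by (auto simp: classical_solution_def w_def)
    moreover have "D x = (\<lambda>_. 0)" using False by (auto simp: D_def)
    ultimately show ?thesis by (simp add: rl_integral_def)
  qed
  obtain C where C: "C > 0"
    and stable: "\<And>V B t. continuous_on {0..T} V \<Longrightarrow>
      (\<And>t. t \<in> {0..T} \<Longrightarrow> \<bar>\<alpha> * V t + \<gamma> * rl_integral \<gamma> V t\<bar> \<le> B) \<Longrightarrow> t \<in> {0..T} \<Longrightarrow> \<bar>V t\<bar> \<le> C * B"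
    by (rule Volterra_stability[OF \<gamma>(1) \<alpha>(1), of \<gamma> T]) (use \<gamma> T in auto)
  have "continuous_on ({0..a} \<times> {0..T}) (\<lambda>(x, t). D x t)"
  proof (rule continuous_on_Times_uniform[OF D_cont])
    fix x e :: real assume x: "x \<in> {0..a}" and e: "e > 0"
    have "uniformly_continuous_on ({0..a} \<times> {0..T}) (\<lambda>(x, t). w x t)"
      using u_cont v_cont
      by (intro compact_uniformly_continuous compact_Times) (auto simp: w_def case_prod_unfold intro!: continuous_intros)
    then obtain d where d: "d > 0"
      and dw: "\<And>p q. p \<in> {0..a} \<times> {0..T} \<Longrightarrow> q \<in> {0..a} \<times> {0..T} \<Longrightarrow> dist q p < d \<Longrightarrow>
        dist (case_prod w q) (case_prod w p) < e / (2 * C)"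
      unfolding uniformly_continuous_on_def using e C
      by (metis (no_types, lifting) divide_pos_pos mult_pos_pos zero_less_numeral)
    have "dist (D y t) (D x t) < e" if y: "y \<in> {0..a}" "dist y x < d" and t: "t \<in> {0..T}" for y t
    proof -
      have "\<bar>D y t - D x t\<bar> \<le> C * (e / (2 * C))"
      proof (rule stable[OF _ _ t])
        show "continuous_on {0..T} (\<lambda>t. D y t - D x t)" by (intro continuous_intros D_cont)
        fix s assume s: "s \<in> {0..T}"
        have sub: "{0..s} \<subseteq> {0..T}" using s by simp
        have "\<gamma> * rl_integral \<gamma> (\<lambda>t. D y t - D x t) s = \<gamma> * rl_integral \<gamma> (D y) s - \<gamma> * rl_integral \<gamma> (D x) s"
          using rl_integral_diff[OF \<gamma>(1) continuous_on_subset[OF D_cont sub] continuous_on_subset[OF D_cont sub], of y x]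
          by (simp only: right_diff_distrib)
        moreover have "\<alpha> * (D y s - D x s) = \<alpha> * D y s - \<alpha> * D x s" by (rule right_diff_distrib)
        ultimately have "\<alpha> * (D y s - D x s) + \<gamma> * rl_integral \<gamma> (\<lambda>t. D y t - D x t) s = w y s - w x s"
          using D_eq[OF y(1) s] D_eq[OF x s] by linarith
        then show "\<bar>\<alpha> * (D y s - D x s) + \<gamma> * rl_integral \<gamma> (\<lambda>t. D y t - D x t) s\<bar> \<le> e / (2 * C)"
          using dw[of "(x, s)" "(y, s)"] x y s by (simp add: dist_Pair_Pair dist_real_def)
      qed
      then show ?thesis using C e by (simp add: dist_real_def)
    qed
    then show "\<exists>d>0. \<forall>y\<in>{0..a}. dist y x < d \<longrightarrow> (\<forall>t\<in>{0..T}. dist (D y t) (D x t) < e)"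
      using d by blast
  qed
  moreover have "compact ({0..a} \<times> {0..T})" "{0..a} \<times> {0..T} \<noteq> {}"
    using a T by (auto intro!: compact_Times)
  ultimately obtain x0 t0 where x0: "x0 \<in> {0..a}" and t0: "t0 \<in> {0..T}"
    and max: "\<And>x t. x \<in> {0..a} \<Longrightarrow> t \<in> {0..T} \<Longrightarrow> D x t \<le> D x0 t0"
    using continuous_attains_sup[of "{0..a} \<times> {0..T}" "\<lambda>(x, t). D x t"] by fastforce
  have "D x0 t0 \<le> 0"
  proof (rule ccontr)
    assume "\<not> D x0 t0 \<le> 0"
    then have pos: "0 < D x0 t0" by simp
    then have x0': "x0 \<in> {0<..<a}" by (auto simp: D_def split: if_splits)
    have "D x0 0 = 0"
    proof -
      have "rl_integral \<gamma> (D x0) 0 = 0"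
        using rl_kernel_eq_0 by (auto simp: rl_integral_def indicator_def intro!: integral_eq_zero_AE)
      moreover have "w x0 0 = 0" using u v x0 by (simp add: classical_solution_def w_def)
      ultimately show ?thesis using D_eq[OF x0, of 0] T \<alpha> by simp
    qed
    then have t0': "t0 \<in> {0<..T}" using pos t0 by (cases "t0 = 0") auto
    obtain ut uxx where ut: "(u x0 has_real_derivative ut) (at t0 within {0<..T})"
      "has_second_derivative_at (\<lambda>y. AB_derivative T \<gamma> (u y) t0) uxx x0" "ut = uxx + F x0 t0"
      using u x0' t0' unfolding classical_solution_def \<gamma>_def by blast
    obtain vt vxx where vt: "(v x0 has_real_derivative vt) (at t0 within {0<..T})"
      "has_second_derivative_at (\<lambda>y. AB_derivative T \<gamma> (v y) t0) vxx x0" "vt = vxx + F x0 t0"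
      using v x0' t0' unfolding classical_solution_def \<gamma>_def by blast
    have "uxx - vxx \<le> 0"
    proof (rule second_derivative_nonpos_at_local_maximum)
      show "has_second_derivative_at (\<lambda>y. AB_derivative T \<gamma> (u y) t0 - AB_derivative T \<gamma> (v y) t0) (uxx - vxx) x0"
        using ut(2) vt(2) by (rule has_second_derivative_at_diff)
      have "\<forall>\<^sub>F y in nhds x0. y \<in> {0<..<a}" using x0' by (intro eventually_nhds_in_open) auto
      then show "\<forall>\<^sub>F y in nhds x0. AB_derivative T \<gamma> (u y) t0 - AB_derivative T \<gamma> (v y) t0
          \<le> AB_derivative T \<gamma> (u x0) t0 - AB_derivative T \<gamma> (v x0) t0"
      proof eventually_elim
        case (elim y)
        then show ?case using max[of y t0] t0 x0' by (simp add: D_def)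
      qed
    qed
    moreover have "0 < ut - vt"
    proof (rule derivative_pos_at_positive_maximum[where V = "D x0" and w = "w x0"])
      show "(w x0 has_real_derivative ut - vt) (at t0 within {0<..T})"
        unfolding w_def using ut(1) vt(1) by (rule DERIV_diff)
      show "w x0 t = \<alpha> * D x0 t + \<gamma> * rl_integral \<gamma> (D x0) t" if "t \<in> {0..T}" for t
        using D_eq[OF x0 that] by simp
      show "D x0 s \<le> D x0 t0" if "s \<in> {0..t0}" for s using max[OF x0, of s] that t0 by simp
    qed (use \<gamma> \<alpha> t0' pos D_cont in auto)
    ultimately show False using ut(3) vt(3) by simp
  qed
  then have "D x t \<le> 0" using max[of x t] x t by simp
  then show ?thesis using x by (simp add: D_def \<gamma>_def)
qed

theorem theorem3p3:
  fixes a T \<alpha> :: real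
    and F :: "real \<Rightarrow> real \<Rightarrow> real"
    and \<phi> lam mu :: "real \<Rightarrow> real"
  assumes "0 < a" and "0 < T" and "0 < \<alpha>" and "\<alpha> < 1"
    and "continuous_on ({0..a} \<times> {0..T}) (\<lambda>(x, t). F x t)"
    and "continuous_on {0..a} \<phi>"
    and "continuous_on {0..T} lam" and "continuous_on {0..T} mu"
    and "mono_on {0..T} lam" and "mono_on {0..T} mu"
  shows "\<forall>u v. classical_solution a T \<alpha> F \<phi> lam mu u \<longrightarrow> classical_solution a T \<alpha> F \<phi> lam mu v \<longrightarrow>
           (\<forall>x\<in>{0..a}. \<forall>t\<in>{0..T}. u x t = v x t)"
proof (intro allI impI ballI)
  fix u v x t
  assume u: "classical_solution a T \<alpha> F \<phi> lam mu u" and v: "classical_solution a T \<alpha> F \<phi> lam mu v"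
    and x: "x \<in> {0..a}" and t: "t \<in> {0..T}"
  show "u x t = v x t"
  proof (cases "x \<in> {0<..<a}")
    case False
    then have "x = 0 \<or> x = a" using x by auto
    then show ?thesis using u v t by (auto simp: classical_solution_def)
  next
    case True
    have AB_eq: "AB_derivative T (1 - \<alpha>) (u x) s = AB_derivative T (1 - \<alpha>) (v x) s" if "s \<in> {0..T}" for s
      using AB_derivative_solution_le[OF assms(1-4) u v True that]
        AB_derivative_solution_le[OF assms(1-4) v u True that] by simp
    \<comment> \<open>The inversion formula recovers a solution from its initial value and its fractional derivative.\<close>
    have inv: "f x t = \<phi> x + (\<alpha> * AB_derivative T (1 - \<alpha>) (f x) t
        + (1 - \<alpha>) * rl_integral (1 - \<alpha>) (AB_derivative T (1 - \<alpha>) (f x)) t)"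
      if f: "classical_solution a T \<alpha> F \<phi> lam mu f" for f
    proof -
      have c: "continuous_on ({0..a} \<times> {0..T}) (\<lambda>(x, t). f x t)" and "sobolev_W12 T (f x)" "f x 0 = \<phi> x"
        using f x True by (auto simp: classical_solution_def)
      moreover have "continuous_on {0..T} (f x)"
        using c x by (rule continuous_on_slice)
      ultimately show ?thesis using AB_derivative_W12(2)[of "1 - \<alpha>" T "f x" t] t assms by simp
    qed
    have "rl_integral (1 - \<alpha>) (AB_derivative T (1 - \<alpha>) (u x)) t = rl_integral (1 - \<alpha>) (AB_derivative T (1 - \<alpha>) (v x)) t"
      unfolding rl_integral_def
      by (rule Bochner_Integration.integral_cong) (use AB_eq t in \<open>auto simp: indicator_def\<close>)
    then show ?thesis using inv[OF u] inv[OF v] AB_eq[OF t] by simp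
  qed
qed

end
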